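(* Let $\mathcal{A}$ be a $C^*$-algebra, $\mathcal{B}$ a $C^*$-subalgebra of $\mathcal{A}$, and $\mathcal{E}:\mathcal{A}\to\mathcal{B}$ a tracial conditional expectation. Then $$U_{\rho,\mathcal{E}}(A)\,U_{\rho,\mathcal{E}}(B)\;\geq\;\frac14\left|\mathcal{E}(\rho[A,B])\right|^2$$ for all self-adjoint $A,B\in\mathcal{A}$ and each $\mathcal{E}$-density operator $\rho\in\mathcal{A}$.
   Context: A conditional expectation $\mathcal{E}:\mathcal{A}\to\mathcal{B}$ is a positive contractive linear map such that $\mathcal{E}(BAC)=B\mathcal{E}(A)C$ for all $A\in\mathcal{A}$ and $B,C\in\mathcal{B}$. It is tracial if $\mathcal{E}(XY)=\mathcal{E}(YX)$ for all $X,Y\in\mathcal{A}$. An $\mathcal{E}$-density operator is a positive $\rho\in\mathcal{A}$ with $\mathcal{E}(\rho)=I$, the unit. $[A,B]=AB-BA$, $|X|=(X^*X)^{1/2}$. For self-adjoint $A\in\mathcal{A}$, $$V_{\rho,\mathcal{E}}(A)=\mathcal{E}(\rho A^2)-\mathcal{E}(\rho A)^2,\qquad I_{\rho,\mathcal{E}}(A)=\mathcal{E}(\rho A^2)-\mathcal{E}(\rho^{1/2}A\rho^{1/2}A),$$ $$J_{\rho,\mathcal{E}}(A)=2V_{\rho,\mathcal{E}}(A)-I_{\rho,\mathcal{E}}(A),\qquad U_{\rho,\mathcal{E}}(A)=I_{\rho,\mathcal{E}}(A)\,\sharp\,J_{\rho,\mathcal{E}}(A).$$ $C^*$-algebras are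 regarded as algebras of bounded operators on a Hilbert space. The geometric mean is $X\sharp Y=X^{1/2}\big(X^{-1/2}YX^{-1/2}\big)^{1/2}X^{1/2}$ for $X$ positive invertible and $Y\ge0$; for general $X,Y\geq 0$ it is the strong-operator limit of $(X+\varepsilon I)\sharp(Y+\varepsilon I)$ as $\varepsilon\downarrow0$. *)

theory Defs
  imports "HOL-Analysis.Analysis"
begin

text \<open>
  Complex Hilbert spaces, built on top of the real Hilbert space structure of \<^class>\<open>real_inner\<close>
  so that norm, topology and the type of bounded operators come from the library. The inner
  product is conjugate-linear in its first argument and linear in its second one.
\<close>

class complex_inner = real_inner +
  fixes scaleC :: "complex \<Rightarrow> 'a \<Rightarrow> 'a"  (infixr \<open>*\<^sub>C\<close> 75)
    and cinner :: "'a \<Rightarrow> 'a \<Rightarrow> complex"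
  assumes scaleC_add_right: "c *\<^sub>C (x + y) = c *\<^sub>C x + c *\<^sub>C y"
    and scaleC_add_left: "(c + d) *\<^sub>C x = c *\<^sub>C x + d *\<^sub>C x"
    and scaleC_scaleC: "c *\<^sub>C d *\<^sub>C x = (c * d) *\<^sub>C x"
    and scaleR_scaleC: "r *\<^sub>R x = complex_of_real r *\<^sub>C x"
    and cinner_commute: "cinner x y = cnj (cinner y x)"
    and cinner_add_right: "cinner x (y + z) = cinner x y + cinner x z"
    and cinner_scaleC_right: "cinner x (c *\<^sub>C y) = c * cinner x y"
    and inner_eq_Re_cinner: "inner x y = Re (cinner x y)"

class complex_hilbert_space = complex_inner + complete_space

lemma norm_scaleC: "norm (c *\<^sub>C (x :: 'a :: complex_inner)) = cmod c * norm x"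
proof -
  have "cinner (c *\<^sub>C x) (c *\<^sub>C x) = c * cnj c * cinner x x"
    by (metis (no_types) cinner_commute cinner_scaleC_right complex_cnj_mult mult.assoc
        mult.left_commute)
  also have "\<dots> = complex_of_real ((cmod c)\<^sup>2) * cinner x x"
    by (simp only: complex_norm_square)
  finally have "inner (c *\<^sub>C x) (c *\<^sub>C x) = (cmod c)\<^sup>2 * inner x x"
    by (simp add: inner_eq_Re_cinner)
  then show ?thesis
    by (simp add: norm_eq_sqrt_inner real_sqrt_mult)
qed

lemma bounded_linear_scaleC: "bounded_linear (\<lambda>x :: 'a :: complex_inner. c *\<^sub>C x)"
  by (rule bounded_linear_intro[where K = "cmod c"])
    (simp_all add: scaleC_add_right scaleR_scaleC scaleC_scaleC norm_scaleC mult.commute)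

text \<open>
  A bounded operator of a complex Hilbert space is a \<^typ>\<open>'h::complex_hilbert_space \<Rightarrow>\<^sub>L 'h\<close>
  (bounded and real-linear) that commutes with complex scalars.
\<close>

definition clinear_op :: "('h::complex_hilbert_space \<Rightarrow>\<^sub>L 'h) \<Rightarrow> bool" where
  "clinear_op T \<longleftrightarrow> (\<forall>c x. blinfun_apply T (c *\<^sub>C x) = c *\<^sub>C blinfun_apply T x)"

lift_definition cscale :: "complex \<Rightarrow> ('h::complex_hilbert_space \<Rightarrow>\<^sub>L 'h) \<Rightarrow> ('h \<Rightarrow>\<^sub>L 'h)"
  is "\<lambda>c T x. c *\<^sub>C T x"
  by (rule bounded_linear_compose[OF bounded_linear_scaleC])

definition adj :: "('h::complex_hilbert_space \<Rightarrow>\<^sub>L 'h) \<Rightarrow> ('h \<Rightarrow>\<^sub>L 'h)" where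
  "adj T = (THE S. \<forall>x y. cinner (blinfun_apply S x) y = cinner x (blinfun_apply T y))"

definition self_adjoint :: "('h::complex_hilbert_space \<Rightarrow>\<^sub>L 'h) \<Rightarrow> bool" where
  "self_adjoint T \<longleftrightarrow> adj T = T"

definition positive_op :: "('h::complex_hilbert_space \<Rightarrow>\<^sub>L 'h) \<Rightarrow> bool" where
  "positive_op T \<longleftrightarrow> clinear_op T \<and> (\<forall>x. cinner x (blinfun_apply T x) \<in> \<real>\<^sub>\<ge>\<^sub>0)"

definition op_le :: "('h::complex_hilbert_space \<Rightarrow>\<^sub>L 'h) \<Rightarrow> ('h \<Rightarrow>\<^sub>L 'h) \<Rightarrow> bool"
  (infix \<open>\<le>\<^sub>o\<^sub>p\<close> 50) where
  "S \<le>\<^sub>o\<^sub>p T \<longleftrightarrow> positive_op (T - S)"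

definition op_sqrt :: "('h::complex_hilbert_space \<Rightarrow>\<^sub>L 'h) \<Rightarrow> ('h \<Rightarrow>\<^sub>L 'h)" where
  "op_sqrt T = (THE S. positive_op S \<and> S o\<^sub>L S = T)"

definition op_inv :: "('h::complex_hilbert_space \<Rightarrow>\<^sub>L 'h) \<Rightarrow> ('h \<Rightarrow>\<^sub>L 'h)" where
  "op_inv T = (THE S. S o\<^sub>L T = id_blinfun \<and> T o\<^sub>L S = id_blinfun)"

definition op_abs :: "('h::complex_hilbert_space \<Rightarrow>\<^sub>L 'h) \<Rightarrow> ('h \<Rightarrow>\<^sub>L 'h)" where
  "op_abs T = op_sqrt (adj T o\<^sub>L T)"

definition commutator :: "('h::complex_hilbert_space \<Rightarrow>\<^sub>L 'h) \<Rightarrow> ('h \<Rightarrow>\<^sub>L 'h) \<Rightarrow> ('h \<Rightarrow>\<^sub>L 'h)" where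
  "commutator S T = (S o\<^sub>L T) - (T o\<^sub>L S)"

text \<open>
  \<open>gmean_inv\<close> is meant for positive invertible \<open>X\<close> and positive \<open>Y\<close>. There it agrees with the general
  mean \<open>gmean\<close>, which is therefore taken to be the strong-operator limit in all cases.
\<close>

definition gmean_inv :: "('h::complex_hilbert_space \<Rightarrow>\<^sub>L 'h) \<Rightarrow> ('h \<Rightarrow>\<^sub>L 'h) \<Rightarrow> ('h \<Rightarrow>\<^sub>L 'h)" where
  "gmean_inv X Y =
     op_sqrt X o\<^sub>L op_sqrt (op_inv (op_sqrt X) o\<^sub>L Y o\<^sub>L op_inv (op_sqrt X)) o\<^sub>L op_sqrt X"

definition gmean :: "('h::complex_hilbert_space \<Rightarrow>\<^sub>L 'h) \<Rightarrow> ('h \<Rightarrow>\<^sub>L 'h) \<Rightarrow> ('h \<Rightarrow>\<^sub>L 'h)"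
  (infixl \<open>\<sharp>\<close> 70) where
  "X \<sharp> Y = (THE L. limitin strong_operator_topology
     (\<lambda>\<epsilon>::real. gmean_inv (X + \<epsilon> *\<^sub>R id_blinfun) (Y + \<epsilon> *\<^sub>R id_blinfun)) L (at_right 0))"

text \<open>
  A \<open>C\<^sup>*\<close>-algebra is a norm-closed self-adjoint subalgebra of the bounded operators on a complex
  Hilbert space. It is not required to contain the identity operator.
\<close>

definition cstar_algebra :: "('h::complex_hilbert_space \<Rightarrow>\<^sub>L 'h) set \<Rightarrow> bool" where
  "cstar_algebra \<A> \<longleftrightarrow>
     (\<forall>X\<in>\<A>. clinear_op X) \<and>
     0 \<in> \<A> \<and>
     (\<forall>X\<in>\<A>. \<forall>Y\<in>\<A>. X + Y \<in> \<A>) \<and>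
     (\<forall>c. \<forall>X\<in>\<A>. cscale c X \<in> \<A>) \<and>
     (\<forall>X\<in>\<A>. \<forall>Y\<in>\<A>. X o\<^sub>L Y \<in> \<A>) \<and>
     (\<forall>X\<in>\<A>. adj X \<in> \<A>) \<and>
     closed \<A>"

definition cstar_subalgebra ::
    "('h::complex_hilbert_space \<Rightarrow>\<^sub>L 'h) set \<Rightarrow> ('h \<Rightarrow>\<^sub>L 'h) set \<Rightarrow> bool" where
  "cstar_subalgebra \<B> \<A> \<longleftrightarrow> cstar_algebra \<B> \<and> \<B> \<subseteq> \<A>"

text \<open>
  A conditional expectation is a total function here, but only its values on \<open>\<A>\<close> are constrained.
\<close>

definition conditional_expectation ::
    "('h::complex_hilbert_space \<Rightarrow>\<^sub>L 'h) set \<Rightarrow> ('h \<Rightarrow>\<^sub>L 'h) set \<Rightarrow>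
     (('h \<Rightarrow>\<^sub>L 'h) \<Rightarrow> ('h \<Rightarrow>\<^sub>L 'h)) \<Rightarrow> bool" where
  "conditional_expectation \<A> \<B> \<E> \<longleftrightarrow>
     (\<forall>X\<in>\<A>. \<E> X \<in> \<B>) \<and>
     (\<forall>X\<in>\<A>. \<forall>Y\<in>\<A>. \<E> (X + Y) = \<E> X + \<E> Y) \<and>
     (\<forall>c. \<forall>X\<in>\<A>. \<E> (cscale c X) = cscale c (\<E> X)) \<and>
     (\<forall>X\<in>\<A>. positive_op X \<longrightarrow> positive_op (\<E> X)) \<and>
     (\<forall>X\<in>\<A>. norm (\<E> X) \<le> norm X) \<and>
     (\<forall>X\<in>\<A>. \<forall>Y\<in>\<B>. \<forall>Z\<in>\<B>. \<E> (Y o\<^sub>L X o\<^sub>L Z) = Y o\<^sub>L \<E> X o\<^sub>L Z)"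

definition tracial ::
    "('h::complex_hilbert_space \<Rightarrow>\<^sub>L 'h) set \<Rightarrow> (('h \<Rightarrow>\<^sub>L 'h) \<Rightarrow> ('h \<Rightarrow>\<^sub>L 'h)) \<Rightarrow> bool" where
  "tracial \<A> \<E> \<longleftrightarrow> (\<forall>X\<in>\<A>. \<forall>Y\<in>\<A>. \<E> (X o\<^sub>L Y) = \<E> (Y o\<^sub>L X))"

definition density_operator ::
    "('h::complex_hilbert_space \<Rightarrow>\<^sub>L 'h) set \<Rightarrow> (('h \<Rightarrow>\<^sub>L 'h) \<Rightarrow> ('h \<Rightarrow>\<^sub>L 'h)) \<Rightarrow> ('h \<Rightarrow>\<^sub>L 'h) \<Rightarrow> bool" where
  "density_operator \<A> \<E> \<rho> \<longleftrightarrow> \<rho> \<in> \<A> \<and> positive_op \<rho> \<and> \<E> \<rho> = id_blinfun"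

definition V_op ::
    "('h::complex_hilbert_space \<Rightarrow>\<^sub>L 'h) \<Rightarrow> (('h \<Rightarrow>\<^sub>L 'h) \<Rightarrow> ('h \<Rightarrow>\<^sub>L 'h)) \<Rightarrow> ('h \<Rightarrow>\<^sub>L 'h) \<Rightarrow> ('h \<Rightarrow>\<^sub>L 'h)" where
  "V_op \<rho> \<E> A = \<E> (\<rho> o\<^sub>L (A o\<^sub>L A)) - (\<E> (\<rho> o\<^sub>L A) o\<^sub>L \<E> (\<rho> o\<^sub>L A))"

definition I_op ::
    "('h::complex_hilbert_space \<Rightarrow>\<^sub>L 'h) \<Rightarrow> (('h \<Rightarrow>\<^sub>L 'h) \<Rightarrow> ('h \<Rightarrow>\<^sub>L 'h)) \<Rightarrow> ('h \<Rightarrow>\<^sub>L 'h) \<Rightarrow> ('h \<Rightarrow>\<^sub>L 'h)" where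
  "I_op \<rho> \<E> A = \<E> (\<rho> o\<^sub>L (A o\<^sub>L A)) - \<E> (op_sqrt \<rho> o\<^sub>L A o\<^sub>L op_sqrt \<rho> o\<^sub>L A)"

definition J_op ::
    "('h::complex_hilbert_space \<Rightarrow>\<^sub>L 'h) \<Rightarrow> (('h \<Rightarrow>\<^sub>L 'h) \<Rightarrow> ('h \<Rightarrow>\<^sub>L 'h)) \<Rightarrow> ('h \<Rightarrow>\<^sub>L 'h) \<Rightarrow> ('h \<Rightarrow>\<^sub>L 'h)" where
  "J_op \<rho> \<E> A = 2 *\<^sub>R V_op \<rho> \<E> A - I_op \<rho> \<E> A"

definition U_op ::
    "('h::complex_hilbert_space \<Rightarrow>\<^sub>L 'h) \<Rightarrow> (('h \<Rightarrow>\<^sub>L 'h) \<Rightarrow> ('h \<Rightarrow>\<^sub>L 'h)) \<Rightarrow> ('h \<Rightarrow>\<^sub>L 'h) \<Rightarrow> ('h \<Rightarrow>\<^sub>L 'h)" where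
  "U_op \<rho> \<E> A = I_op \<rho> \<E> A \<sharp> J_op \<rho> \<E> A"

end

theory Submission
  imports Defs
begin

text \<open>
  The tracial property forces the range algebra to be commutative: for \<open>Y\<close> and \<open>Z\<close> in \<open>\<B>\<close>, both
  \<open>Y Z\<close> and \<open>Z Y\<close> equal \<open>\<E>(Y \<rho> Z) = \<E>(\<rho> Z Y)\<close>, because \<open>\<E>(\<rho>) = I\<close> (lemma \<open>B_commute\<close>). All of
  \<open>I\<close>, \<open>J\<close>, \<open>U\<close> and \<open>\<E>(\<rho>[A,B])\<close> therefore commute with each other, and the geometric mean of two
  commuting positive operators is simply \<open>(X Y)\<^sup>1\<^sup>/\<^sup>2\<close> (\<open>gmean_commuting\<close>), so \<open>U(A)\<^sup>2 = I(A) J(A)\<close>.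

  Write \<open>s = \<rho>\<^sup>1\<^sup>/\<^sup>2\<close> and \<open>B\<^sub>0 = B - \<E>(\<rho> B)\<close>, and put \<open>X = s A - A s\<close>, \<open>Y = s B\<^sub>0 + B\<^sub>0 s\<close>. Cycling products
  under the trace gives \<open>\<E>(X\<^sup>* X) = 2 I(A)\<close>, \<open>\<E>(Y\<^sup>2) = 2 J(B)\<close> and \<open>\<E>(X Y) = \<E>(\<rho>[A,B])\<close>. The
  operator-valued Cauchy--Schwarz inequality \<open>\<E>(X\<^sup>* Y) \<E>(Y\<^sup>* X) \<le> \<E>(X\<^sup>* X) \<E>(Y\<^sup>* Y)\<close>
  (\<open>E_Cauchy_Schwarz\<close>) then yields \<open>K \<le> I(A) J(B)\<close> for \<open>K = |\<E>(\<rho>[A,B])|\<^sup>2 / 4\<close>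
  (\<open>I_J_uncertainty\<close>), and with the roles exchanged \<open>K \<le> I(B) J(A)\<close>. Multiplying the two, which is
  legitimate for commuting operators, gives \<open>K\<^sup>2 \<le> (U(A) U(B))\<^sup>2\<close>, and taking square roots preserves
  the order (\<open>psd_root_mono\<close>).

  The functional analysis behind this is developed from the real inner product alone: an operator
  is positive in the complex sense exactly when it is complex linear and positive semidefinite for
  the real inner product (\<open>positive_op_iff_psd\<close>). Square roots are norm limits of polynomials,
  so they stay in every norm-closed unital algebra, in particular in every commutant.
\<close>

section \<open>Adjoint pairs and positive semidefinite operators\<close>

text \<open>
  The relation is used instead of an adjoint operation, so that the algebra of adjoints needs no
  existence theorem; on complex linear operators it agrees with \<open>adj\<close> (\<open>is_adjoint_adj\<close>).
\<close>

definition is_adjoint :: "('a::real_inner \<Rightarrow>\<^sub>L 'a) \<Rightarrow> ('a \<Rightarrow>\<^sub>L 'a) \<Rightarrow> bool" where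
  "is_adjoint S T \<longleftrightarrow> (\<forall>x y. inner (S x) y = inner x (T y))"

text \<open>
  On a real space nonnegativity of the quadratic form does not imply symmetry, so symmetry is part
  of the definition.
\<close>

definition psd :: "('a::real_inner \<Rightarrow>\<^sub>L 'a) \<Rightarrow> bool" where
  "psd T \<longleftrightarrow> is_adjoint T T \<and> (\<forall>x. 0 \<le> inner x (T x))"

interpretation blinfun_compose: bounded_bilinear "(o\<^sub>L)"
  by (rule bounded_bilinear_blinfun_compose)

lemma blinfun_compose_assoc: "(a o\<^sub>L b) o\<^sub>L c = a o\<^sub>L (b o\<^sub>L c)"
  by (rule blinfun_eqI) simp

lemma id_blinfun_compose [simp]: "id_blinfun o\<^sub>L a = a" "a o\<^sub>L id_blinfun = a"
  by (rule blinfun_eqI, simp)+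

lemmas compose_expand = blinfun_compose.add_left blinfun_compose.add_right
  blinfun_compose.diff_left blinfun_compose.diff_right blinfun_compose.minus_left
  blinfun_compose.minus_right blinfun_compose.scaleR_left blinfun_compose.scaleR_right
  blinfun_compose_assoc

lemma is_adjointD: "is_adjoint S T \<Longrightarrow> inner (S x) y = inner x (T y)"
  by (simp add: is_adjoint_def)

lemma is_adjoint_sym: "is_adjoint S T \<Longrightarrow> is_adjoint T S"
  unfolding is_adjoint_def by (metis inner_commute)

lemma is_adjoint_add: "is_adjoint S T \<Longrightarrow> is_adjoint S' T' \<Longrightarrow> is_adjoint (S + S') (T + T')"
  by (simp add: is_adjoint_def blinfun.bilinear_simps inner_add_left inner_add_right)

lemma is_adjoint_diff: "is_adjoint S T \<Longrightarrow> is_adjoint S' T' \<Longrightarrow> is_adjoint (S - S') (T - T')"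
  by (simp add: is_adjoint_def blinfun.bilinear_simps inner_diff_left inner_diff_right)

lemma is_adjoint_scaleR: "is_adjoint S T \<Longrightarrow> is_adjoint (c *\<^sub>R S) (c *\<^sub>R T)"
  by (simp add: is_adjoint_def blinfun.bilinear_simps)

lemma is_adjoint_compose: "is_adjoint S T \<Longrightarrow> is_adjoint S' T' \<Longrightarrow> is_adjoint (S o\<^sub>L S') (T' o\<^sub>L T)"
  by (simp add: is_adjoint_def)

lemma is_adjoint_id: "is_adjoint id_blinfun id_blinfun"
  by (simp add: is_adjoint_def)

lemma is_adjoint_zero: "is_adjoint 0 0"
  by (simp add: is_adjoint_def)

lemma is_adjoint_unique:
  assumes "is_adjoint S T" "is_adjoint S' T" shows "S = S'"
proof (rule blinfun_eqI)
  fix x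
  have "inner (S x - S' x) y = 0" for y
    using assms by (simp add: is_adjoint_def inner_diff_left)
  from this[of "S x - S' x"] show "S x = S' x" by simp
qed

lemmas is_adjoint_intros = is_adjoint_add is_adjoint_diff is_adjoint_scaleR is_adjoint_id

lemma psd_adj: "psd T \<Longrightarrow> is_adjoint T T"
  and psd_inner: "psd T \<Longrightarrow> 0 \<le> inner x (T x)"
  by (simp_all add: psd_def)

lemma psd_add: "psd S \<Longrightarrow> psd T \<Longrightarrow> psd (S + T)"
  by (simp add: psd_def is_adjoint_add blinfun.bilinear_simps inner_add_right)

lemma psd_scaleR: "0 \<le> c \<Longrightarrow> psd T \<Longrightarrow> psd (c *\<^sub>R T)"
  by (simp add: psd_def is_adjoint_scaleR blinfun.bilinear_simps)

lemma psd_id: "psd id_blinfun"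
  by (simp add: psd_def is_adjoint_id)

lemma psd_conjugate:
  assumes "is_adjoint S T" "psd D" shows "psd (S o\<^sub>L (D o\<^sub>L T))"
  using assms is_adjoint_sym[OF assms(1)]
  by (auto simp: psd_def is_adjoint_def)
     (metis inner_commute)

lemma psd_adjoint_compose: "is_adjoint S T \<Longrightarrow> psd (S o\<^sub>L T)"
  using psd_conjugate[OF _ psd_id, of S T] by simp

lemma psd_square: "is_adjoint T T \<Longrightarrow> psd (T o\<^sub>L T)"
  by (rule psd_adjoint_compose)

text \<open>
  Lets a positive perturbation tend to zero. It turns the arguments below that need an invertible
  operator into statements about arbitrary positive ones.
\<close>

lemma psd_of_psd_add_eps:
  fixes T :: "'a::real_inner \<Rightarrow>\<^sub>L 'a"
  assumes "\<And>d::real. 0 < d \<Longrightarrow> psd (T + d *\<^sub>R S)"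
  shows "psd T"
proof -
  have 0: "is_adjoint T T"
  proof -
    \<comment> \<open>\<open>T = 2 (T + S) - (T + 2 S)\<close> is a combination of two of the given symmetric operators.\<close>
    have "is_adjoint (2 *\<^sub>R (T + 1 *\<^sub>R S) - (T + 2 *\<^sub>R S)) (2 *\<^sub>R (T + 1 *\<^sub>R S) - (T + 2 *\<^sub>R S))"
      by (intro is_adjoint_diff is_adjoint_scaleR psd_adj assms) simp_all
    then show ?thesis by (simp add: algebra_simps scaleR_2)
  qed
  have "0 \<le> inner x (T x)" for x
  proof (rule tendsto_lowerbound)
    have "((\<lambda>d. inner x (T x) + d * inner x (S x)) \<longlongrightarrow> inner x (T x) + 0 * inner x (S x)) (at_right 0)"
      by (intro tendsto_intros)
    then show "((\<lambda>d. inner x (T x) + d * inner x (S x)) \<longlongrightarrow> inner x (T x)) (at_right 0)"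
      by simp
    show "\<forall>\<^sub>F d in at_right 0. 0 \<le> inner x (T x) + d * inner x (S x)"
      using eventually_at_right_less[of "0::real"]
    proof eventually_elim
      case (elim d)
      from psd_inner[OF assms[OF elim], of x] show ?case
        by (simp add: blinfun.bilinear_simps inner_add_right)
    qed
  qed simp
  with 0 show ?thesis by (simp add: psd_def)
qed

text \<open>
  A positive operator defines a semi-inner product; the quadratic form is nonnegative on
  \<open>s x - t y\<close>, and \<open>s = \<langle>y, K y\<rangle>\<close>, \<open>t = \<langle>x, K y\<rangle>\<close> is the optimal choice unless \<open>\<langle>y, K y\<rangle> = 0\<close>.
\<close>

lemma psd_Cauchy_Schwarz:
  assumes "psd K"
  shows "(inner x (K y))\<^sup>2 \<le> inner x (K x) * inner y (K y)"
proof -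
  let ?a = "inner x (K x)" and ?b = "inner x (K y)" and ?c = "inner y (K y)"
  have sym: "inner y (K x) = ?b"
    using is_adjointD[OF psd_adj[OF assms], of y x] by (simp add: inner_commute)
  have q: "0 \<le> s\<^sup>2 * ?a - 2 * s * t * ?b + t\<^sup>2 * ?c" for s t :: real
  proof -
    have "0 \<le> inner (s *\<^sub>R x - t *\<^sub>R y) (K (s *\<^sub>R x - t *\<^sub>R y))"
      by (rule psd_inner[OF assms])
    also have "\<dots> = s\<^sup>2 * ?a - 2 * s * t * ?b + t\<^sup>2 * ?c"
      by (simp add: blinfun.bilinear_simps inner_diff_left inner_diff_right sym
          power2_eq_square algebra_simps)
    finally show ?thesis .
  qed
  have a: "0 \<le> ?a" and c: "0 \<le> ?c" using psd_inner[OF assms] by auto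
  show ?thesis
  proof (cases "?c = 0")
    case True
    have "?b = 0"
    proof (rule ccontr)
      assume "?b \<noteq> 0"
      \<comment> \<open>With \<open>\<langle>y, K y\<rangle> = 0\<close> the form is affine in \<open>t\<close>; this \<open>t\<close> makes it equal to \<open>-1\<close>.\<close>
      with q[of 1 "(?a + 1) / (2 * ?b)"] True show False by (simp add: field_simps)
    qed
    then show ?thesis using True by simp
  next
    case False
    with c have cpos: "0 < ?c" by simp
    have "0 \<le> ?c * (?a * ?c - ?b\<^sup>2)"
      using q[of ?c ?b] by (simp add: power2_eq_square algebra_simps)
    with cpos show ?thesis by (simp add: zero_le_mult_iff)
  qed
qed

text \<open>
  Cauchy--Schwarz for the form of \<open>K\<close>, applied to \<open>K y\<close> and \<open>y\<close>, bounds \<open>\<parallel>K y\<parallel>\<^sup>4\<close> by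
  \<open>k \<parallel>K y\<parallel>\<^sup>2 \<cdot> k \<parallel>y\<parallel>\<^sup>2\<close>. This replaces the spectral radius formula.
\<close>

lemma psd_norm_le:
  assumes K: "psd K" and kK: "psd (k *\<^sub>R id_blinfun - K)" and "0 \<le> k"
  shows "norm K \<le> k"
proof (rule norm_blinfun_bound[OF \<open>0 \<le> k\<close>])
  fix y
  have ub: "inner x (K x) \<le> k * (norm x)\<^sup>2" for x
    using psd_inner[OF kK, of x]
    by (simp add: blinfun.bilinear_simps inner_diff_right dot_square_norm)
  let ?n = "norm (K y)"
  have "(?n\<^sup>2)\<^sup>2 = (inner (K y) (K y))\<^sup>2" by (simp add: dot_square_norm)
  also have "\<dots> \<le> inner (K y) (K (K y)) * inner y (K y)"
    by (rule psd_Cauchy_Schwarz[OF K])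
  also have "\<dots> \<le> (k * ?n\<^sup>2) * (k * (norm y)\<^sup>2)"
    by (intro mult_mono ub mult_nonneg_nonneg psd_inner[OF K] \<open>0 \<le> k\<close>) simp_all
  finally have *: "?n\<^sup>2 * ?n\<^sup>2 \<le> ?n\<^sup>2 * (k * norm y)\<^sup>2"
    by (simp add: power_mult_distrib power2_eq_square mult_ac)
  show "?n \<le> k * norm y"
  proof (cases "?n = 0")
    case False
    then have "0 < ?n\<^sup>2" by simp
    with * have "?n\<^sup>2 \<le> (k * norm y)\<^sup>2" by (rule mult_left_le_imp_le)
    then show ?thesis by (rule power2_le_imp_le) (use \<open>0 \<le> k\<close> in simp)
  qed (use \<open>0 \<le> k\<close> in simp)
qed

lemma abs_inner_blinfun_le:
  fixes T :: "'a::real_inner \<Rightarrow>\<^sub>L 'a"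
  shows "\<bar>inner x (T x)\<bar> \<le> norm T * (norm x)\<^sup>2"
proof -
  have "\<bar>inner x (T x)\<bar> \<le> norm x * norm (T x)" by (rule Cauchy_Schwarz_ineq2)
  also have "\<dots> \<le> norm x * (norm T * norm x)" by (intro mult_left_mono norm_blinfun) simp
  finally show ?thesis by (simp add: power2_eq_square mult_ac)
qed

lemma psd_norm_bounds:
  fixes T :: "'a::real_inner \<Rightarrow>\<^sub>L 'a"
  assumes "is_adjoint T T" "norm T \<le> k"
  shows "psd (k *\<^sub>R id_blinfun - T)" "psd (T + k *\<^sub>R id_blinfun)"
proof -
  have "\<bar>inner x (T x)\<bar> \<le> k * (norm x)\<^sup>2" for x
    using abs_inner_blinfun_le[of x T] mult_right_mono[OF assms(2), of "(norm x)\<^sup>2"] by simp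
  then have "inner x (T x) \<le> k * (norm x)\<^sup>2" "0 \<le> inner x (T x) + k * (norm x)\<^sup>2" for x
    by (smt (verit))+
  with assms(1) show "psd (k *\<^sub>R id_blinfun - T)" "psd (T + k *\<^sub>R id_blinfun)"
    by (auto simp: psd_def blinfun.bilinear_simps inner_add_right inner_diff_right
        dot_square_norm intro!: is_adjoint_intros)
qed

lemma closed_is_adjoint: "closed {T :: 'a::real_inner \<Rightarrow>\<^sub>L 'a. is_adjoint T T}"
proof -
  have "{T :: 'a \<Rightarrow>\<^sub>L 'a. is_adjoint T T} = (\<Inter>x. \<Inter>y. {T :: 'a \<Rightarrow>\<^sub>L 'a. inner (T x) y = inner x (T y)})"
    by (auto simp: is_adjoint_def)
  also have "closed \<dots>"
    by (intro closed_INT ballI closed_Collect_eq continuous_intros)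
  finally show ?thesis .
qed

section \<open>Square roots\<close>

definition unital_closed_algebra :: "('a::real_normed_vector \<Rightarrow>\<^sub>L 'a) set \<Rightarrow> bool" where
  "unital_closed_algebra P \<longleftrightarrow> closed P \<and> id_blinfun \<in> P \<and>
     (\<forall>X\<in>P. \<forall>Y\<in>P. X + Y \<in> P) \<and> (\<forall>c. \<forall>X\<in>P. c *\<^sub>R X \<in> P) \<and> (\<forall>X\<in>P. \<forall>Y\<in>P. X o\<^sub>L Y \<in> P)"

lemma unital_closed_algebraD:
  assumes "unital_closed_algebra P"
  shows "closed P" "id_blinfun \<in> P" "X \<in> P \<Longrightarrow> Y \<in> P \<Longrightarrow> X + Y \<in> P"
    "X \<in> P \<Longrightarrow> c *\<^sub>R X \<in> P" "X \<in> P \<Longrightarrow> Y \<in> P \<Longrightarrow> X o\<^sub>L Y \<in> P"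
    "X \<in> P \<Longrightarrow> Y \<in> P \<Longrightarrow> X - Y \<in> P" "0 \<in> P"
proof -
  show "closed P" and 1: "id_blinfun \<in> P" and add: "X \<in> P \<Longrightarrow> Y \<in> P \<Longrightarrow> X + Y \<in> P"
    and scale: "X \<in> P \<Longrightarrow> c *\<^sub>R X \<in> P" and "X \<in> P \<Longrightarrow> Y \<in> P \<Longrightarrow> X o\<^sub>L Y \<in> P" for X Y c
    using assms by (auto simp: unital_closed_algebra_def)
  show "X - Y \<in> P" if "X \<in> P" "Y \<in> P"
    using add[OF that(1) scale[OF that(2), of "-1"]] by simp
  show "0 \<in> P" using scale[OF 1, of 0] by simp
qed

lemma unital_closed_algebra_commutant:
  fixes D :: "'a::real_normed_vector \<Rightarrow>\<^sub>L 'a"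
  shows "unital_closed_algebra {X. X o\<^sub>L D = D o\<^sub>L X}"
  unfolding unital_closed_algebra_def
proof (intro conjI)
  show "closed {X. X o\<^sub>L D = D o\<^sub>L X}"
    by (intro closed_Collect_eq continuous_intros)
qed (auto simp: compose_expand, metis blinfun_compose_assoc)

text \<open>
  If \<open>Y = (K + Y\<^sup>2)/2\<close> then \<open>(I - Y)\<^sup>2 = I - K\<close>. The iteration \<open>Z \<mapsto> (K + Z\<^sup>2)/2\<close> from \<open>0\<close> is dominated,
  term by term, by the scalar iteration \<open>t \<mapsto> (1 + t\<^sup>2)/2\<close>, which increases and stays below \<open>1\<close>; hence
  it is norm-Cauchy, even when \<open>\<parallel>K\<parallel> = 1\<close> and the map is not a contraction. The last property
  records that the limit lies in every closed set that the iteration does not leave.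
\<close>

lemma exists_contraction_root:
  fixes K :: "'a::{real_inner,banach} \<Rightarrow>\<^sub>L 'a"
  assumes K: "norm K \<le> 1"
  obtains Y where "norm Y \<le> 1" "2 *\<^sub>R Y = K + (Y o\<^sub>L Y)"
    "\<And>P. closed P \<Longrightarrow> 0 \<in> P \<Longrightarrow> (\<And>X. X \<in> P \<Longrightarrow> (1/2) *\<^sub>R (K + (X o\<^sub>L X)) \<in> P) \<Longrightarrow> Y \<in> P"
proof -
  define F where "F X = (1/2) *\<^sub>R (K + (X o\<^sub>L X))" for X
  define f where "f t = (1 + t\<^sup>2) / 2" for t :: real
  define Z where "Z n = (F ^^ n) 0" for n
  define z where "z n = (f ^^ n) 0" for n
  have Z_Suc: "Z (Suc n) = F (Z n)" and z_Suc: "z (Suc n) = f (z n)" for n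
    by (simp_all add: Z_def z_def)
  have z01: "0 \<le> z n \<and> z n \<le> 1" for n
  proof (induction n)
    case (Suc n)
    then have "(z n)\<^sup>2 \<le> 1" by (simp add: power_le_one)
    then show ?case by (simp add: z_Suc f_def)
  qed (simp add: z_def)
  have z_mono: "z n \<le> z (Suc n)" for n
    using zero_le_power2[of "z n - 1"] by (simp add: z_Suc f_def power2_diff)
  have nZ: "norm (Z n) \<le> z n" for n
  proof (induction n)
    case (Suc n)
    have "norm (Z n o\<^sub>L Z n) \<le> norm (Z n) * norm (Z n)" by (rule norm_blinfun_compose)
    also have "\<dots> \<le> (z n)\<^sup>2"
      using mult_mono[OF Suc Suc] z01[of n] by (simp add: power2_eq_square)
    finally have "norm (K + (Z n o\<^sub>L Z n)) \<le> 1 + (z n)\<^sup>2"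
      using K norm_triangle_ineq[of K "Z n o\<^sub>L Z n"] by linarith
    then show ?case by (simp add: Z_Suc z_Suc F_def f_def)
  qed (simp add: Z_def z_def)
  have step: "norm (Z (Suc n) - Z n) \<le> z (Suc n) - z n" for n
  proof (induction n)
    case 0
    then show ?case using K by (simp add: Z_def z_def F_def f_def)
  next
    case (Suc n)
    let ?D = "Z (Suc n) - Z n"
    \<comment> \<open>\<open>P\<^sup>2 - Q\<^sup>2 = P (P - Q) + (P - Q) Q\<close> needs no commutativity.\<close>
    have "Z (Suc (Suc n)) - Z (Suc n) = (1/2) *\<^sub>R ((Z (Suc n) o\<^sub>L ?D) + (?D o\<^sub>L Z n))"
      unfolding Z_Suc[of "Suc n"] by (simp add: Z_Suc[of n] F_def compose_expand algebra_simps)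
    also have "norm \<dots> \<le> (1/2) * (norm (Z (Suc n) o\<^sub>L ?D) + norm (?D o\<^sub>L Z n))"
      by (simp add: norm_triangle_ineq)
    also have "\<dots> \<le> (1/2) * (norm (Z (Suc n)) * norm ?D + norm ?D * norm (Z n))"
      by (intro mult_left_mono add_mono norm_blinfun_compose) simp
    also have "\<dots> \<le> (1/2) * (z (Suc n) * (z (Suc n) - z n) + (z (Suc n) - z n) * z n)"
      using z_mono[of n] z01
      by (intro mult_left_mono add_mono mult_mono nZ Suc) simp_all
    also have "\<dots> = z (Suc (Suc n)) - z (Suc n)"
      unfolding z_Suc[of "Suc n"] by (simp add: z_Suc[of n] f_def power2_eq_square algebra_simps)
    finally show ?case .
  qed
  have "convergent z"
    by (rule Bseq_monoseq_convergent)
      (auto simp: Bseq_def monoseq_Suc z_mono z01 intro!: exI[of _ 1])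
  then have "Cauchy z" by (simp add: convergent_Cauchy)
  have dist: "norm (Z m - Z n) \<le> z m - z n" if "n \<le> m" for m n
    using that
  proof (induction m rule: dec_induct)
    case (step m)
    then show ?case
      using norm_triangle_ineq[of "Z (Suc m) - Z m" "Z m - Z n"] \<open>\<And>n. norm (Z (Suc n) - Z n) \<le> _\<close>[of m]
      by simp
  qed simp
  have "Cauchy Z"
  proof (rule metric_CauchyI)
    fix e :: real assume "0 < e"
    from metric_CauchyD[OF \<open>Cauchy z\<close> this] obtain M where
      M: "\<And>m n. M \<le> m \<Longrightarrow> M \<le> n \<Longrightarrow> dist (z m) (z n) < e" by blast
    have "dist (Z m) (Z n) < e" if "M \<le> m" "M \<le> n" for m n
      using dist[of n m] dist[of m n] M[OF that]
      by (cases "n \<le> m") (auto simp: dist_norm norm_minus_commute)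
    then show "\<exists>M. \<forall>m\<ge>M. \<forall>n\<ge>M. dist (Z m) (Z n) < e" by blast
  qed
  then obtain Y where Y: "Z \<longlonglongrightarrow> Y"
    using Cauchy_convergent convergent_def by blast
  show ?thesis
  proof
    show "norm Y \<le> 1"
      by (rule LIMSEQ_le_const2[OF tendsto_norm[OF Y]]) (meson nZ z01 order_trans)
    have "(\<lambda>n. F (Z n)) \<longlonglongrightarrow> F Y" unfolding F_def by (intro tendsto_intros Y)
    moreover have "(\<lambda>n. F (Z n)) \<longlonglongrightarrow> Y" using LIMSEQ_Suc[OF Y] by (simp add: Z_Suc)
    ultimately have "F Y = Y" by (rule LIMSEQ_unique)
    then have "2 *\<^sub>R Y = 2 *\<^sub>R F Y" by simp
    then show "2 *\<^sub>R Y = K + (Y o\<^sub>L Y)" by (simp add: F_def)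
    fix P assume P: "closed P" "0 \<in> P" "\<And>X. X \<in> P \<Longrightarrow> (1/2) *\<^sub>R (K + (X o\<^sub>L X)) \<in> P"
    have "Z n \<in> P" for n
      by (induction n) (simp_all add: P(2) Z_def P(3) F_def)
    then show "Y \<in> P" using closed_sequentially[OF P(1) _ Y] by blast
  qed
qed

text \<open>
  After rescaling, \<open>K = I - T/c\<close> satisfies \<open>0 \<le> K \<le> I\<close> and the iteration applies. That the root lies
  in every closed unital algebra containing \<open>T\<close> gives membership in the C*-algebra and, applied to
  commutants, commutation with everything that commutes with \<open>T\<close>.
\<close>

lemma exists_psd_root:
  fixes T :: "'a::{real_inner,banach} \<Rightarrow>\<^sub>L 'a"
  assumes T: "psd T"
  obtains R where "psd R" "R o\<^sub>L R = T" "\<And>P. unital_closed_algebra P \<Longrightarrow> T \<in> P \<Longrightarrow> R \<in> P"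
proof -
  define c where "c = norm T + 1"
  have c: "0 < c" "norm T \<le> c" by (simp_all add: c_def add_nonneg_pos)
  define K where "K = id_blinfun - (1/c) *\<^sub>R T"
  have symK: "is_adjoint K K" unfolding K_def by (intro is_adjoint_intros psd_adj T)
  have "K = (1/c) *\<^sub>R (c *\<^sub>R id_blinfun - T)" using c by (simp add: K_def algebra_simps)
  then have "psd K" using psd_scaleR[OF _ psd_norm_bounds(1)[OF psd_adj[OF T] c(2)], of "1/c"] c by simp
  moreover have "psd (1 *\<^sub>R id_blinfun - K)" using psd_scaleR[OF _ T, of "1/c"] c by (simp add: K_def)
  ultimately have "norm K \<le> 1" by (rule psd_norm_le) simp
  from exists_contraction_root[OF this] obtain Y where Y: "norm Y \<le> 1" "2 *\<^sub>R Y = K + (Y o\<^sub>L Y)"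
    "\<And>P. closed P \<Longrightarrow> 0 \<in> P \<Longrightarrow> (\<And>X. X \<in> P \<Longrightarrow> (1/2) *\<^sub>R (K + (X o\<^sub>L X)) \<in> P) \<Longrightarrow> Y \<in> P"
    by blast
  have "Y \<in> {T. is_adjoint T T}"
    by (rule Y(3)[OF closed_is_adjoint])
      (auto intro!: is_adjoint_zero is_adjoint_scaleR is_adjoint_add symK is_adjoint_compose)
  then have symY: "is_adjoint Y Y" by simp
  define R where "R = sqrt c *\<^sub>R (id_blinfun - Y)"
  show ?thesis
  proof
    show "psd R"
      unfolding R_def using psd_norm_bounds(1)[OF symY Y(1)] c by (auto intro!: psd_scaleR)
    have "R o\<^sub>L R = c *\<^sub>R (id_blinfun - 2 *\<^sub>R Y + (Y o\<^sub>L Y))"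
      using c by (simp add: R_def compose_expand scaleR_2 algebra_simps)
    also have "\<dots> = T" using c by (simp add: Y(2) K_def)
    finally show "R o\<^sub>L R = T" .
    fix P assume P: "unital_closed_algebra P" "T \<in> P"
    note D = unital_closed_algebraD[OF P(1)]
    have "K \<in> P" unfolding K_def by (intro D P(2))
    then have "Y \<in> P" by (intro Y(3) D)
    then show "R \<in> P" unfolding R_def by (intro D)
  qed
qed

text \<open>
  The root \<open>Q\<close> constructed above commutes with every other root \<open>S\<close>. For commuting roots,
  \<open>(S - Q)(S + Q) = 0\<close>; so for \<open>y = (S - Q) x\<close> both \<open>\<langle>y, S y\<rangle>\<close> and \<open>\<langle>y, Q y\<rangle>\<close> vanish, which kills
  \<open>S y\<close> and \<open>Q y\<close> and then \<open>\<parallel>y\<parallel>\<^sup>2 = \<langle>x, (S - Q) y\<rangle>\<close>.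
\<close>

lemma psd_root_unique:
  fixes S R :: "'a::{real_inner,banach} \<Rightarrow>\<^sub>L 'a"
  assumes S: "psd S" and R: "psd R" and eq: "S o\<^sub>L S = R o\<^sub>L R"
  shows "S = R"
proof -
  have main: "S = Q" if Q: "psd Q" "Q o\<^sub>L Q = S o\<^sub>L S" "Q o\<^sub>L S = S o\<^sub>L Q" and S: "psd S"
    for S Q :: "'a \<Rightarrow>\<^sub>L 'a"
  proof (rule blinfun_eqI)
    fix x
    define y where "y = S x - Q x"
    have com: "Q (S u) = S (Q u)" for u using Q(3) by (metis blinfun_apply_blinfun_compose)
    have sq: "Q (Q u) = S (S u)" for u using Q(2) by (metis blinfun_apply_blinfun_compose)
    have "inner y (S y) + inner y (Q y) = inner y (S (S x) - Q (Q x))"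
      by (simp add: y_def com blinfun.bilinear_simps inner_add_right inner_diff_right)
    also have "\<dots> = 0" by (simp add: sq)
    finally have "inner y (S y) = 0" "inner y (Q y) = 0"
      using psd_inner[OF S, of y] psd_inner[OF Q(1), of y] by linarith+
    then have "(inner (S y) (S y))\<^sup>2 \<le> 0" "(inner (Q y) (Q y))\<^sup>2 \<le> 0"
      using psd_Cauchy_Schwarz[OF S, of "S y" y] psd_Cauchy_Schwarz[OF Q(1), of "Q y" y] by auto
    then have "S y - Q y = 0" by simp
    moreover have "inner y y = inner x (S y - Q y)"
      using is_adjointD[OF psd_adj[OF S], of x y] is_adjointD[OF psd_adj[OF Q(1)], of x y]
      by (simp add: y_def inner_diff_right inner_diff_left)
    ultimately have "inner y y = 0" by simp
    then show "S x = Q x" by (simp add: y_def)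
  qed
  obtain Q where Q: "psd Q" "Q o\<^sub>L Q = S o\<^sub>L S"
    "\<And>P. unital_closed_algebra P \<Longrightarrow> S o\<^sub>L S \<in> P \<Longrightarrow> Q \<in> P"
    using exists_psd_root[OF psd_square[OF psd_adj[OF S]]] by blast
  have cS: "Q o\<^sub>L S = S o\<^sub>L Q"
    using Q(3)[OF unital_closed_algebra_commutant[of S]] by (simp add: blinfun_compose_assoc)
  have cR: "Q o\<^sub>L R = R o\<^sub>L Q"
    using Q(3)[OF unital_closed_algebra_commutant[of R]] by (simp add: blinfun_compose_assoc eq)
  have "S = Q" by (rule main[OF Q(1,2) cS S])
  moreover have "R = Q" by (rule main[OF Q(1) _ cR R]) (simp add: Q(2) eq)
  ultimately show ?thesis by simp
qed

section \<open>Inverses and commuting positive operators\<close>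

text \<open>
  With \<open>c\<close> large, \<open>K = I - T/c\<close> has norm at most \<open>1 - d/c < 1\<close>, so \<open>X \<mapsto> I + K X\<close> is a contraction of the
  space of operators; its fixed point \<open>X\<close> satisfies \<open>(I - K) X = I\<close>.
\<close>

lemma exists_inverse_of_coercive:
  fixes T :: "'a::{real_inner,banach} \<Rightarrow>\<^sub>L 'a"
  assumes T: "psd (T - d *\<^sub>R id_blinfun)" and d: "0 < d"
  obtains Z where "Z o\<^sub>L T = id_blinfun" "T o\<^sub>L Z = id_blinfun"
proof -
  define c where "c = norm T + d"
  have c: "0 < c" "d \<le> c" "norm T \<le> c" using d by (simp_all add: c_def add_nonneg_pos)
  have symT: "is_adjoint T T"
    using is_adjoint_add[OF psd_adj[OF T] is_adjoint_scaleR[OF is_adjoint_id, of d]] by simp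
  define K where "K = id_blinfun - (1/c) *\<^sub>R T"
  define k where "k = 1 - d/c"
  have k: "0 \<le> k" "k < 1" using c d by (simp_all add: k_def)
  have "K = (1/c) *\<^sub>R (c *\<^sub>R id_blinfun - T)" using c by (simp add: K_def algebra_simps)
  then have "psd K" using psd_scaleR[OF _ psd_norm_bounds(1)[OF symT c(3)], of "1/c"] c by simp
  moreover have "k *\<^sub>R id_blinfun - K = (1/c) *\<^sub>R (T - d *\<^sub>R id_blinfun)"
    by (simp add: K_def k_def algebra_simps)
  then have "psd (k *\<^sub>R id_blinfun - K)" using psd_scaleR[OF _ T, of "1/c"] c by simp
  ultimately have nK: "norm K \<le> k" using k(1) by (rule psd_norm_le)
  have contr: "dist (id_blinfun + (K o\<^sub>L X)) (id_blinfun + (K o\<^sub>L Y)) \<le> k * dist X Y" for X Y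
  proof -
    have "dist (id_blinfun + (K o\<^sub>L X)) (id_blinfun + (K o\<^sub>L Y)) = norm (K o\<^sub>L (X - Y))"
      by (simp add: dist_norm compose_expand)
    also have "\<dots> \<le> norm K * norm (X - Y)" by (rule norm_blinfun_compose)
    also have "\<dots> \<le> k * dist X Y" by (simp add: dist_norm mult_right_mono nK)
    finally show ?thesis .
  qed
  have "\<exists>!X. id_blinfun + (K o\<^sub>L X) = X"
    using contr by (intro banach_fix_type[OF k]) blast
  then obtain X where X: "id_blinfun + (K o\<^sub>L X) = X" by blast
  define Z where "Z = (1/c) *\<^sub>R X"
  have Teq: "T = c *\<^sub>R (id_blinfun - K)" using c by (simp add: K_def)
  have "T o\<^sub>L Z = X - (K o\<^sub>L X)" using c by (simp add: Teq Z_def compose_expand)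
  also have "\<dots> = id_blinfun" using X by (metis add_diff_cancel_right')
  finally have TZ: "T o\<^sub>L Z = id_blinfun" .
  have inj: "x = 0" if "T x = 0" for x
  proof -
    have "0 \<le> inner x ((T - d *\<^sub>R id_blinfun) x)" by (rule psd_inner[OF T])
    then have "d * inner x x \<le> 0" by (simp add: blinfun.bilinear_simps inner_diff_right that)
    then have "inner x x \<le> 0" using d by (simp add: mult_le_0_iff)
    then show ?thesis by (metis antisym inner_ge_zero inner_eq_zero_iff)
  qed
  have "Z o\<^sub>L T = id_blinfun"
  proof (rule blinfun_eqI)
    fix x
    have "T (Z (T x)) = T x" using TZ by (metis blinfun_apply_blinfun_compose blinfun_apply_id_blinfun id_apply)
    then have "T (Z (T x) - x) = 0" by (simp add: blinfun.bilinear_simps)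
    then show "(Z o\<^sub>L T) x = id_blinfun x" using inj by fastforce
  qed
  with TZ that show ?thesis by blast
qed

lemma psd_root_commute:
  assumes "psd S"
    and "S o\<^sub>L D = D o\<^sub>L S"
  obtains R where "psd R" "R o\<^sub>L R = (S :: 'a::{real_inner,banach} \<Rightarrow>\<^sub>L 'a)" "R o\<^sub>L D = D o\<^sub>L R"
proof -
  obtain R where R: "psd R" "R o\<^sub>L R = S" "\<And>P. unital_closed_algebra P \<Longrightarrow> S \<in> P \<Longrightarrow> R \<in> P"
    using exists_psd_root[OF assms(1)] by blast
  have "R \<in> {X. X o\<^sub>L D = D o\<^sub>L X}"
    by (rule R(3)[OF unital_closed_algebra_commutant]) (simp add: assms(2))
  with R that show ?thesis by blast
qed

text \<open>
  With \<open>R\<close> the root of \<open>S\<close>, commutation gives \<open>S T = R T R\<close>.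
\<close>

lemma psd_compose_commuting:
  fixes S T :: "'a::{real_inner,banach} \<Rightarrow>\<^sub>L 'a"
  assumes "psd S" "psd T" "S o\<^sub>L T = T o\<^sub>L S"
  shows "psd (S o\<^sub>L T)"
proof -
  obtain R where R: "psd R" "R o\<^sub>L R = S" "R o\<^sub>L T = T o\<^sub>L R"
    using psd_root_commute[OF assms(1,3)] by blast
  have "psd (R o\<^sub>L (T o\<^sub>L R))" by (rule psd_conjugate[OF psd_adj[OF R(1)] assms(2)])
  also have "R o\<^sub>L (T o\<^sub>L R) = S o\<^sub>L T" by (simp add: R(2,3)[symmetric] blinfun_compose_assoc)
  finally show ?thesis .
qed

text \<open>
  Division of an operator inequality by a commuting coercive \<open>S\<close>. If \<open>R\<close> is the root of \<open>S\<close>, then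
  \<open>\<langle>R y, D R y\<rangle> = \<langle>y, S D y\<rangle> \<ge> 0\<close>, and \<open>R\<close> is onto because \<open>S\<close> is invertible.
\<close>

lemma psd_cancel_coercive:
  fixes S D :: "'a::{real_inner,banach} \<Rightarrow>\<^sub>L 'a"
  assumes S: "psd (S - d *\<^sub>R id_blinfun)" and d: "0 < d" and D: "is_adjoint D D"
    and com: "S o\<^sub>L D = D o\<^sub>L S" and SD: "psd (S o\<^sub>L D)"
  shows "psd D"
proof -
  have "psd S" using psd_add[OF S psd_scaleR[OF _ psd_id, of d]] d by simp
  from psd_root_commute[OF this com] obtain R
    where R: "psd R" "R o\<^sub>L R = S" "R o\<^sub>L D = D o\<^sub>L R" by blast
  obtain Z where Z: "S o\<^sub>L Z = id_blinfun" using exists_inverse_of_coercive[OF S d] by blast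
  have "0 \<le> inner x (D x)" for x
  proof -
    define y where "y = R (Z x)"
    have x: "x = R y"
      using Z by (metis R(2) blinfun_apply_blinfun_compose blinfun_apply_id_blinfun id_apply y_def)
    have "inner x (D x) = inner y (R (D (R y)))"
      unfolding x by (rule is_adjointD[OF psd_adj[OF R(1)]])
    also have "R (D (R y)) = (S o\<^sub>L D) y"
      by (metis R(2,3) blinfun_apply_blinfun_compose)
    finally show ?thesis using psd_inner[OF SD, of y] by simp
  qed
  with D show ?thesis by (simp add: psd_def)
qed

text \<open>
  Formally one divides \<open>R\<^sup>2 - S\<^sup>2 = (R + S)(R - S)\<close> by \<open>R + S\<close>. Since \<open>R + S\<close> may fail to be invertible,
  \<open>d > 0\<close> is added to both factors; \<open>(R + S + d)(R - S + d) = R\<^sup>2 - S\<^sup>2 + 2 d R + d\<^sup>2\<close> is still positive.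
\<close>

lemma psd_root_mono:
  fixes R S :: "'a::{real_inner,banach} \<Rightarrow>\<^sub>L 'a"
  assumes R: "psd R" and S: "psd S" and com: "R o\<^sub>L S = S o\<^sub>L R"
    and le: "psd ((R o\<^sub>L R) - (S o\<^sub>L S))"
  shows "psd (R - S)"
proof (rule psd_of_psd_add_eps)
  fix d :: real assume d: "0 < d"
  show "psd (R - S + d *\<^sub>R id_blinfun)"
  proof (rule psd_cancel_coercive[OF _ d])
    show "psd ((R + S + d *\<^sub>R id_blinfun) - d *\<^sub>R id_blinfun)"
      using psd_add[OF R S] by simp
    show "is_adjoint (R - S + d *\<^sub>R id_blinfun) (R - S + d *\<^sub>R id_blinfun)"
      by (intro is_adjoint_intros psd_adj R S)
    show "(R + S + d *\<^sub>R id_blinfun) o\<^sub>L (R - S + d *\<^sub>R id_blinfun)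
        = (R - S + d *\<^sub>R id_blinfun) o\<^sub>L (R + S + d *\<^sub>R id_blinfun)"
      by (simp add: compose_expand com algebra_simps)
    have "(R + S + d *\<^sub>R id_blinfun) o\<^sub>L (R - S + d *\<^sub>R id_blinfun)
        = ((R o\<^sub>L R) - (S o\<^sub>L S)) + (d *\<^sub>R R + d *\<^sub>R R + (d * d) *\<^sub>R id_blinfun)"
      by (simp add: compose_expand com algebra_simps)
    also have "psd \<dots>"
      by (intro psd_add le psd_scaleR R psd_id) (use d in simp_all)
    finally show "psd ((R + S + d *\<^sub>R id_blinfun) o\<^sub>L (R - S + d *\<^sub>R id_blinfun))" .
  qed
qed

text \<open>
  Continuity of the square root: \<open>R \<ge> S\<close> gives \<open>(R - S)\<^sup>2 \<le> (R - S)(R + S) = R\<^sup>2 - S\<^sup>2\<close>.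
\<close>

lemma norm_root_diff_le:
  fixes R S :: "'a::{real_inner,banach} \<Rightarrow>\<^sub>L 'a"
  assumes R: "psd R" and S: "psd S" and com: "R o\<^sub>L S = S o\<^sub>L R"
    and le: "psd ((R o\<^sub>L R) - (S o\<^sub>L S))"
  shows "(norm (R - S))\<^sup>2 \<le> norm ((R o\<^sub>L R) - (S o\<^sub>L S))"
proof -
  let ?D = "R - S" and ?E = "(R o\<^sub>L R) - (S o\<^sub>L S)"
  have D: "psd ?D" by (rule psd_root_mono[OF assms])
  have "psd (S o\<^sub>L ?D)"
    by (rule psd_compose_commuting[OF S D]) (simp add: compose_expand com)
  moreover have "?E = (?D o\<^sub>L ?D) + 2 *\<^sub>R (S o\<^sub>L ?D)"
    by (simp add: compose_expand com algebra_simps scaleR_2)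
  ultimately have le: "inner x ((?D o\<^sub>L ?D) x) \<le> inner x (?E x)" for x
    using psd_inner[of "S o\<^sub>L ?D" x] by (simp add: blinfun.add_left blinfun.scaleR_left inner_add_right)
  have "norm ?D \<le> sqrt (norm ?E)"
  proof (rule norm_blinfun_bound)
    fix x
    have "(norm (?D x))\<^sup>2 = inner x ((?D o\<^sub>L ?D) x)"
      using is_adjointD[OF psd_adj[OF D], of x "?D x"] by (simp add: dot_square_norm)
    also have "\<dots> \<le> norm ?E * (norm x)\<^sup>2"
      using le[of x] abs_inner_blinfun_le[of x ?E] by linarith
    also have "\<dots> = (sqrt (norm ?E) * norm x)\<^sup>2" by (simp add: power_mult_distrib)
    finally show "norm (?D x) \<le> sqrt (norm ?E) * norm x"
      by (rule power2_le_imp_le) simp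
  qed simp
  from power_mono[OF this, of 2] show ?thesis by simp
qed

section \<open>Complex Hilbert spaces\<close>

instance complex_hilbert_space \<subseteq> banach ..

lemma inner_scaleC_left: "inner (c *\<^sub>C x) y = inner x (cnj c *\<^sub>C y)"
proof -
  have "cinner (c *\<^sub>C x) y = cnj c * cinner x y"
    by (metis cinner_commute cinner_scaleC_right complex_cnj_mult)
  then show ?thesis by (simp add: inner_eq_Re_cinner cinner_scaleC_right)
qed

lemma scaleC_one: "1 *\<^sub>C (x :: 'a::complex_inner) = x"
  by (metis of_real_1 scaleR_one scaleR_scaleC)

lemma scaleC_minus_left: "(- c) *\<^sub>C (x :: 'a::complex_inner) = - (c *\<^sub>C x)"
  by (metis (no_types, lifting) add.right_inverse add_eq_0_iff scaleC_add_left scaleR_scaleC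
      of_real_0 scaleR_zero_left)

lemma inner_imaginary: "inner (\<i> *\<^sub>C x) (\<i> *\<^sub>C y) = inner x y"
  "inner (\<i> *\<^sub>C x) y = - inner x (\<i> *\<^sub>C y)"
  by (simp_all add: inner_scaleC_left scaleC_scaleC scaleC_one scaleC_minus_left)

lemma Im_cinner: "Im (cinner x y) = - inner x (\<i> *\<^sub>C y)"
  by (simp add: inner_eq_Re_cinner cinner_scaleC_right)

text \<open>
  A complex number is determined by the real parts of itself and of its multiple by \<open>\<i>\<close>; so complex
  adjoint relations reduce to real ones.
\<close>

lemma cinner_eq_iff: "(\<forall>x y. cinner (S x) y = cinner x (T y)) \<longleftrightarrow>
    (\<forall>x y. inner (S x) y = inner x (T y)) \<and> (\<forall>x y. inner (S x) (\<i> *\<^sub>C y) = inner x (\<i> *\<^sub>C T y))"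
  by (auto simp: complex_eq_iff Im_cinner inner_eq_Re_cinner)

lemma clinear_opD: "clinear_op T \<Longrightarrow> T (c *\<^sub>C x) = c *\<^sub>C T x"
  by (simp add: clinear_op_def)

text \<open>
  That \<open>\<langle>x, T x\<rangle>\<close> is real for all \<open>x\<close> says that the form \<open>\<langle>x, \<i> T x\<rangle>\<close> of the real inner product vanishes.
  Polarizing with \<open>x\<close> and \<open>\<i> y\<close> gives the symmetry of \<open>T\<close>; conversely, for symmetric \<open>T\<close> this form
  equals its own negative.
\<close>

lemma positive_op_iff_psd:
  fixes T :: "'h::complex_hilbert_space \<Rightarrow>\<^sub>L 'h"
  shows "positive_op T \<longleftrightarrow> clinear_op T \<and> psd T"
proof -
  have *: "(\<forall>x. cinner x (T x) \<in> \<real>\<^sub>\<ge>\<^sub>0) \<longleftrightarrow> psd T" if T: "clinear_op T"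
  proof
    assume a: "\<forall>x. cinner x (T x) \<in> \<real>\<^sub>\<ge>\<^sub>0"
    then have im: "inner x (\<i> *\<^sub>C T x) = 0" and re: "0 \<le> inner x (T x)" for x
      by (auto simp: complex_nonneg_Reals_iff Im_cinner inner_eq_Re_cinner dest!: spec[of _ x])
    have "inner (T x) y = inner x (T y)" for x y
    proof -
      have "inner (x + \<i> *\<^sub>C y) (\<i> *\<^sub>C T (x + \<i> *\<^sub>C y)) = 0" by (rule im)
      then have "inner y (T x) = inner x (T y)"
        by (simp add: blinfun.bilinear_simps clinear_opD[OF T] scaleC_add_right inner_add_left
            inner_add_right inner_diff_right linear_simps[OF bounded_linear_scaleC] im inner_imaginary scaleC_scaleC scaleC_minus_left scaleC_one)
      then show ?thesis by (simp add: inner_commute)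
    qed
    with re show "psd T" by (simp add: psd_def is_adjoint_def)
  next
    assume a: "psd T"
    have "inner x (\<i> *\<^sub>C T x) = 0" for x
    proof -
      have "inner x (\<i> *\<^sub>C T x) = inner x (T (\<i> *\<^sub>C x))" by (simp add: clinear_opD[OF T])
      also have "\<dots> = inner (T x) (\<i> *\<^sub>C x)" using is_adjointD[OF psd_adj[OF a]] by simp
      also have "\<dots> = - inner x (\<i> *\<^sub>C T x)" by (simp add: inner_commute[of "T x"] inner_imaginary)
      finally show ?thesis by simp
    qed
    then show "\<forall>x. cinner x (T x) \<in> \<real>\<^sub>\<ge>\<^sub>0"
      using psd_inner[OF a] by (simp add: complex_nonneg_Reals_iff Im_cinner inner_eq_Re_cinner)
  qed
  then show ?thesis unfolding positive_op_def by blast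
qed

lemma unital_closed_algebra_clinear:
  "unital_closed_algebra {T :: 'h::complex_hilbert_space \<Rightarrow>\<^sub>L 'h. clinear_op T}"
  unfolding unital_closed_algebra_def
proof (intro conjI)
  have "{T :: 'h \<Rightarrow>\<^sub>L 'h. clinear_op T} = (\<Inter>c. \<Inter>x. {T :: 'h \<Rightarrow>\<^sub>L 'h. T (c *\<^sub>C x) = c *\<^sub>C T x})"
    by (auto simp: clinear_op_def)
  also have "closed \<dots>"
    by (intro closed_INT ballI closed_Collect_eq continuous_intros
        bounded_linear.continuous_on[OF bounded_linear_scaleC])
  finally show "closed {T :: 'h \<Rightarrow>\<^sub>L 'h. clinear_op T}" .
qed (auto simp: clinear_op_def blinfun.bilinear_simps scaleC_add_right scaleR_scaleC scaleC_scaleC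
    mult.commute)

lemma op_sqrt_eqI:
  fixes S T :: "'h::complex_hilbert_space \<Rightarrow>\<^sub>L 'h"
  assumes "positive_op S" "S o\<^sub>L S = T"
  shows "op_sqrt T = S"
  unfolding op_sqrt_def
  by (rule the_equality) (use assms psd_root_unique in \<open>auto simp: positive_op_iff_psd\<close>)

lemma
  fixes T :: "'h::complex_hilbert_space \<Rightarrow>\<^sub>L 'h"
  assumes T: "positive_op T"
  shows op_sqrt_positive: "positive_op (op_sqrt T)"
    and op_sqrt_square: "op_sqrt T o\<^sub>L op_sqrt T = T"
    and op_sqrt_in_algebra: "unital_closed_algebra P \<Longrightarrow> T \<in> P \<Longrightarrow> op_sqrt T \<in> P"
proof -
  obtain R where R: "psd R" "R o\<^sub>L R = T" "\<And>P. unital_closed_algebra P \<Longrightarrow> T \<in> P \<Longrightarrow> R \<in> P"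
    using exists_psd_root[of T] T by (auto simp: positive_op_iff_psd)
  have "positive_op R"
    using R(1) R(3)[OF unital_closed_algebra_clinear] T by (simp add: positive_op_iff_psd)
  then have "op_sqrt T = R" using R(2) by (rule op_sqrt_eqI)
  then show "positive_op (op_sqrt T)" "op_sqrt T o\<^sub>L op_sqrt T = T"
    "unital_closed_algebra P \<Longrightarrow> T \<in> P \<Longrightarrow> op_sqrt T \<in> P"
    using \<open>positive_op R\<close> R by simp_all
qed

lemma op_sqrt_commute:
  assumes "positive_op T" "T o\<^sub>L D = D o\<^sub>L T"
  shows "op_sqrt T o\<^sub>L D = D o\<^sub>L op_sqrt T"
  using op_sqrt_in_algebra[OF assms(1) unital_closed_algebra_commutant[of D]] assms(2) by simp

section \<open>Riesz representation and adjoints\<close>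

text \<open>
  The representing vector minimizes \<open>q(x) = \<parallel>x\<parallel>\<^sup>2 - 2 f(x)\<close>. Minimizing sequences are Cauchy by the
  parallelogram law, and the first variation of \<open>q\<close> at a minimizer is \<open>2 (\<langle>x, y\<rangle> - f(y))\<close>.
\<close>

lemma riesz_representation:
  fixes f :: "'a::{real_inner,banach} \<Rightarrow> real"
  assumes f: "bounded_linear f"
  obtains x where "\<And>y. f y = inner x y"
proof -
  interpret f: bounded_linear f by (rule f)
  define q where "q x = inner x x - 2 * f x" for x
  obtain K where K: "\<And>x. \<bar>f x\<bar> \<le> norm x * K" using f.bounded by auto
  have q_lower: "- K\<^sup>2 \<le> q x" for x
  proof -
    have "0 \<le> (norm x - K)\<^sup>2" by simp
    then show ?thesis using K[of x] by (simp add: q_def dot_square_norm power2_diff)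
  qed
  define m where "m = Inf (range q)"
  have bdd: "bdd_below (range q)" using q_lower by (intro bdd_belowI2)
  have m_le: "m \<le> q x" for x unfolding m_def by (rule cInf_lower[OF _ bdd]) simp
  have "\<exists>x. q x < m + 1 / real (Suc n)" for n
  proof -
    have "\<exists>y\<in>range q. y < m + 1 / real (Suc n)"
      by (rule cInf_lessD) (simp_all add: m_def)
    then show ?thesis by blast
  qed
  then obtain u where u: "\<And>n. q (u n) < m + 1 / real (Suc n)" by metis
  have para: "(norm (x - y))\<^sup>2 \<le> 2 * ((q x - m) + (q y - m))" for x y
  proof -
    have "2 * (q x + q y) - 4 * q ((1/2) *\<^sub>R (x + y)) = inner (x - y) (x - y)"
      by (simp add: q_def f.add f.scaleR inner_add_left inner_add_right inner_diff_left
          inner_diff_right inner_commute algebra_simps)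
    then show ?thesis using m_le[of "(1/2) *\<^sub>R (x + y)"] by (simp add: dot_square_norm)
  qed
  have "Cauchy u"
  proof (rule metric_CauchyI)
    fix e :: real assume "0 < e"
    then obtain N where N: "4 * (1 / real (Suc N)) < e\<^sup>2"
      using reals_Archimedean[of "e\<^sup>2 / 4"] by (auto simp: field_simps)
    have "dist (u i) (u j) < e" if "N \<le> i" "N \<le> j" for i j
    proof -
      have "q (u i) < m + 1 / real (Suc N)" "q (u j) < m + 1 / real (Suc N)"
        using that by (auto intro!: order_less_le_trans[OF u] add_left_mono frac_le)
      then have "(norm (u i - u j))\<^sup>2 < e\<^sup>2"
        using para[of "u i" "u j"] N by argo
      then show ?thesis unfolding dist_norm by (rule power2_less_imp_less) (use \<open>0 < e\<close> in simp)
    qed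
    then show "\<exists>N. \<forall>i\<ge>N. \<forall>j\<ge>N. dist (u i) (u j) < e" by blast
  qed
  then obtain x where x: "u \<longlonglongrightarrow> x" using Cauchy_convergent convergent_def by blast
  have qx: "q x \<le> m"
  proof (rule LIMSEQ_le)
    show "(\<lambda>n. q (u n)) \<longlonglongrightarrow> q x" unfolding q_def by (intro tendsto_intros x f.tendsto)
    show "(\<lambda>n. m + 1 / real (Suc n)) \<longlonglongrightarrow> m"
      using tendsto_add[OF tendsto_const LIMSEQ_inverse_real_of_nat, of m] by (simp add: inverse_eq_divide)
    show "\<exists>N. \<forall>n\<ge>N. q (u n) \<le> m + 1 / real (Suc n)" using u less_imp_le by blast
  qed
  have "f y = inner x y" for y
  proof (rule ccontr)
    define b where "b = inner x y - f y"
    \<comment> \<open>The step \<open>-b / \<parallel>y\<parallel>\<^sup>2\<close> would be optimal; the added \<open>1\<close> avoids a case distinction on \<open>y = 0\<close> and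
      still decreases \<open>q\<close>.\<close>
    define t where "t = - b / (inner y y + 1)"
    assume "f y \<noteq> inner x y"
    then have b: "b \<noteq> 0" by (simp add: b_def)
    have pos: "0 < inner y y + 1" by (simp add: add_nonneg_pos)
    have "0 \<le> q (x + t *\<^sub>R y) - q x" using qx m_le[of "x + t *\<^sub>R y"] by linarith
    also have "\<dots> = 2 * t * b + t\<^sup>2 * inner y y"
      by (simp add: q_def b_def f.add f.scaleR inner_add_left inner_add_right inner_commute
          power2_eq_square algebra_simps)
    also have "\<dots> \<le> 2 * t * b + t\<^sup>2 * (inner y y + 1)" by (simp add: mult_left_mono)
    also have "\<dots> = 2 * t * b + t * (t * (inner y y + 1))"
      by (simp add: power2_eq_square mult.assoc)
    also have "t * (inner y y + 1) = - b" using pos by (simp add: t_def)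
    also have "2 * t * b + t * - b = - b\<^sup>2 / (inner y y + 1)"
      by (simp add: t_def power2_eq_square)
    also have "\<dots> < 0" using b pos by (simp add: divide_neg_pos)
    finally show False by simp
  qed
  then show ?thesis using that by blast
qed

lemma exists_adjoint:
  fixes T :: "'a::{real_inner,banach} \<Rightarrow>\<^sub>L 'a"
  obtains S where "is_adjoint S T"
proof -
  have "\<exists>z. \<forall>y. inner x (T y) = inner z y" for x
  proof -
    have "bounded_linear (\<lambda>y. inner x (T y))"
      by (intro bounded_linear_intros bounded_linear_inner_right_comp blinfun.bounded_linear_right)
    from riesz_representation[OF this] show ?thesis by metis
  qed
  then obtain g where g: "\<And>x y. inner x (T y) = inner (g x) y" by metis
  have eqI: "a = b" if "\<And>y. inner a y = inner b y" for a b :: 'a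
    using that[of "a - b"] by (metis inner_diff_left inner_eq_zero_iff right_minus_eq)
  have "bounded_linear g"
  proof (rule bounded_linear_intro)
    show "g (x + y) = g x + g y" for x y
      by (rule eqI) (simp add: inner_add_left g[symmetric])
    show "g (c *\<^sub>R x) = c *\<^sub>R g x" for c x
      by (rule eqI) (simp add: g[symmetric])
    show "norm (g x) \<le> norm x * norm T" for x
    proof -
      have "norm (g x) * norm (g x) = inner x (T (g x))" by (simp add: g norm_eq_sqrt_inner)
      also have "\<dots> \<le> norm x * norm (T (g x))" by (rule norm_cauchy_schwarz)
      also have "\<dots> \<le> norm x * (norm T * norm (g x))" by (intro mult_left_mono norm_blinfun) simp
      finally have *: "norm (g x) * norm (g x) \<le> (norm x * norm T) * norm (g x)" by (simp add: mult_ac)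
      show ?thesis
      proof (cases "g x = 0")
        case False
        then have "0 < norm (g x)" by simp
        with * show ?thesis by (rule mult_right_le_imp_le)
      qed simp
    qed
  qed
  then have "is_adjoint (Blinfun g) T"
    by (simp add: is_adjoint_def bounded_linear_Blinfun_apply g)
  then show ?thesis by (rule that)
qed

lemma is_adjoint_adj:
  fixes T :: "'h::complex_hilbert_space \<Rightarrow>\<^sub>L 'h"
  assumes T: "clinear_op T"
  shows "is_adjoint (adj T) T"
proof -
  obtain S where S: "is_adjoint S T" by (rule exists_adjoint)
  have "adj T = S"
    unfolding adj_def cinner_eq_iff
  proof (rule the_equality)
    show "(\<forall>x y. inner (S x) y = inner x (T y)) \<and> (\<forall>x y. inner (S x) (\<i> *\<^sub>C y) = inner x (\<i> *\<^sub>C T y))"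
      using S by (simp add: is_adjoint_def clinear_opD[OF T, symmetric])
    fix S' :: "'h \<Rightarrow>\<^sub>L 'h"
    assume "(\<forall>x y. inner (S' x) y = inner x (T y)) \<and> (\<forall>x y. inner (S' x) (\<i> *\<^sub>C y) = inner x (\<i> *\<^sub>C T y))"
    then have "is_adjoint S' T" by (simp add: is_adjoint_def)
    then show "S' = S" using S by (rule is_adjoint_unique)
  qed
  with S show ?thesis by simp
qed

section \<open>The geometric mean of commuting operators\<close>

text \<open>
  Makes the definite description in the definition of \<open>\<sharp>\<close> meaningful: evaluation at each vector is
  continuous for the strong operator topology.
\<close>

lemma limitin_strong_operator_unique:
  fixes f :: "'b \<Rightarrow> ('a::real_normed_vector \<Rightarrow>\<^sub>L 'a)"
  assumes "limitin strong_operator_topology f L F" "limitin strong_operator_topology f M F" "F \<noteq> bot"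
  shows "L = M"
proof (rule blinfun_eqI)
  fix x
  have "((\<lambda>t. f t x) \<longlongrightarrow> N x) F" if "limitin strong_operator_topology f N F" for N
    using continuous_map_limit[OF strong_operator_topology_continuous_evaluation that, of x]
    by (simp add: o_def)
  with assms show "L x = M x" by (blast intro: tendsto_unique)
qed

text \<open>
  A norm limit suffices, since the strong operator topology is weaker than the norm topology.
\<close>

lemma gmean_eqI:
  assumes "((\<lambda>\<epsilon>. gmean_inv (X + \<epsilon> *\<^sub>R id_blinfun) (Y + \<epsilon> *\<^sub>R id_blinfun)) \<longlongrightarrow> L) (at_right 0)"
  shows "X \<sharp> Y = L"
proof -
  have lim: "limitin strong_operator_topology
      (\<lambda>\<epsilon>. gmean_inv (X + \<epsilon> *\<^sub>R id_blinfun) (Y + \<epsilon> *\<^sub>R id_blinfun)) L (at_right 0)"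
    using continuous_map_limit[OF strong_operator_topology_weaker_than_euclidean, of _ L "at_right 0"] assms
    by (simp add: o_def)
  then show ?thesis
    unfolding gmean_def by (intro the_equality limitin_strong_operator_unique[OF _ lim]) simp_all
qed

lemma positive_opI: "clinear_op T \<Longrightarrow> psd T \<Longrightarrow> positive_op T"
  by (simp add: positive_op_iff_psd)

lemma positive_op_psd: "positive_op T \<Longrightarrow> psd T"
  and positive_op_clinear: "positive_op T \<Longrightarrow> clinear_op T"
  by (simp_all add: positive_op_iff_psd)

lemmas clinear_intros = unital_closed_algebraD[OF unital_closed_algebra_clinear, unfolded mem_Collect_eq]

lemma positive_op_compose_commuting:
  "positive_op S \<Longrightarrow> positive_op T \<Longrightarrow> S o\<^sub>L T = T o\<^sub>L S \<Longrightarrow> positive_op (S o\<^sub>L T)"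
  by (simp add: positive_op_iff_psd psd_compose_commuting clinear_intros)

text \<open>
  Let \<open>s = X\<^sup>1\<^sup>/\<^sup>2\<close>, \<open>i = s\<^sup>-\<^sup>1\<close> and \<open>r = (X Y)\<^sup>1\<^sup>/\<^sup>2\<close>, which all commute. Then \<open>i r i\<close> is positive with square
  \<open>i\<^sup>4 X Y = i Y i\<close>, so it is the inner root in the definition of the mean, and \<open>s (i r i) s = r\<close>.
\<close>

lemma gmean_inv_commuting:
  fixes X Y :: "'h::complex_hilbert_space \<Rightarrow>\<^sub>L 'h"
  assumes X: "positive_op X" "psd (X - d *\<^sub>R id_blinfun)" "0 < d"
    and Y: "positive_op Y" and com: "X o\<^sub>L Y = Y o\<^sub>L X"
  shows "gmean_inv X Y = op_sqrt (X o\<^sub>L Y)"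
proof -
  define s where "s = op_sqrt X"
  define r where "r = op_sqrt (X o\<^sub>L Y)"
  have XY: "positive_op (X o\<^sub>L Y)" by (rule positive_op_compose_commuting[OF X(1) Y com])
  have s: "positive_op s" "s o\<^sub>L s = X" and r: "positive_op r" "r o\<^sub>L r = X o\<^sub>L Y"
    using op_sqrt_positive[OF X(1)] op_sqrt_square[OF X(1)] op_sqrt_positive[OF XY]
      op_sqrt_square[OF XY] by (simp_all add: s_def r_def)
  obtain Z where Z: "Z o\<^sub>L X = id_blinfun" "X o\<^sub>L Z = id_blinfun"
    using exists_inverse_of_coercive[OF X(2,3)] by blast
  define i where "i = s o\<^sub>L Z"
  have ZX: "Z o\<^sub>L D = D o\<^sub>L Z" if "X o\<^sub>L D = D o\<^sub>L X" for D
  proof -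
    have "Z o\<^sub>L D = Z o\<^sub>L (D o\<^sub>L (X o\<^sub>L Z))" by (simp add: Z(2))
    also have "\<dots> = Z o\<^sub>L ((X o\<^sub>L D) o\<^sub>L Z)" by (simp add: that blinfun_compose_assoc)
    also have "\<dots> = (Z o\<^sub>L X) o\<^sub>L (D o\<^sub>L Z)" by (simp add: blinfun_compose_assoc)
    finally show ?thesis by (simp add: Z(1))
  qed
  have sX: "s o\<^sub>L X = X o\<^sub>L s" by (simp flip: s(2) add: blinfun_compose_assoc)
  have is1: "s o\<^sub>L i = id_blinfun" unfolding i_def
    by (simp add: blinfun_compose_assoc[symmetric] s(2) Z(2))
  have is2: "i o\<^sub>L s = id_blinfun" unfolding i_def
    by (simp add: blinfun_compose_assoc ZX[OF sX[symmetric]] is1[unfolded i_def])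
  have inv: "op_inv s = i"
    unfolding op_inv_def
  proof (rule the_equality)
    fix j assume "j o\<^sub>L s = id_blinfun \<and> s o\<^sub>L j = id_blinfun"
    then show "j = i" using is1 by (metis blinfun_compose_assoc id_blinfun_compose)
  qed (simp add: is1 is2)
  have sY: "s o\<^sub>L Y = Y o\<^sub>L s"
    unfolding s_def by (rule op_sqrt_commute[OF X(1) com])
  have sr: "r o\<^sub>L s = s o\<^sub>L r"
    unfolding r_def
    by (rule op_sqrt_commute[OF XY])
      (metis blinfun_compose_assoc sX sY)
  have Xr: "X o\<^sub>L r = r o\<^sub>L X" by (metis s(2) sr blinfun_compose_assoc)
  have ir: "i o\<^sub>L r = r o\<^sub>L i"
    unfolding i_def by (metis ZX[OF Xr] sr blinfun_compose_assoc)
  have iY: "i o\<^sub>L Y = Y o\<^sub>L i"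
    unfolding i_def by (metis ZX[OF com] sY blinfun_compose_assoc)
  have symi: "is_adjoint i i"
  proof -
    obtain i' where i': "is_adjoint i' i" by (rule exists_adjoint)
    have "is_adjoint (i' o\<^sub>L s) (s o\<^sub>L i)"
      by (rule is_adjoint_compose[OF i' psd_adj[OF positive_op_psd[OF s(1)]]])
    then have "i' o\<^sub>L s = id_blinfun"
      using is1 is_adjoint_id is_adjoint_unique by metis
    then have "i' = i" using is1 by (metis blinfun_compose_assoc id_blinfun_compose)
    with i' show ?thesis by simp
  qed
  have ci: "clinear_op i"
    unfolding clinear_op_def
  proof (intro allI)
    fix c x
    have "s (i (c *\<^sub>C x)) = c *\<^sub>C x" and "s (i x) = x" using is1
      by (metis blinfun_apply_blinfun_compose blinfun_apply_id_blinfun id_apply)+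
    then have "i (s (i (c *\<^sub>C x))) = i (s (c *\<^sub>C i x))"
      using clinear_opD[OF positive_op_clinear[OF s(1)]] by metis
    then show "i (c *\<^sub>C x) = c *\<^sub>C i x" using is2
      by (metis blinfun_apply_blinfun_compose blinfun_apply_id_blinfun id_apply)
  qed
  have root: "op_sqrt (i o\<^sub>L Y o\<^sub>L i) = i o\<^sub>L (r o\<^sub>L i)"
  proof (rule op_sqrt_eqI)
    show "positive_op (i o\<^sub>L (r o\<^sub>L i))"
      using ci r(1) by (simp add: positive_op_iff_psd clinear_intros psd_conjugate[OF symi])
    have "(i o\<^sub>L (r o\<^sub>L i)) o\<^sub>L (i o\<^sub>L (r o\<^sub>L i)) = i o\<^sub>L i o\<^sub>L (r o\<^sub>L r) o\<^sub>L i o\<^sub>L i"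
      by (metis blinfun_compose_assoc ir)
    also have "\<dots> = i o\<^sub>L (i o\<^sub>L s) o\<^sub>L s o\<^sub>L Y o\<^sub>L i o\<^sub>L i"
      by (simp add: r(2) s(2)[symmetric] blinfun_compose_assoc)
    also have "\<dots> = i o\<^sub>L Y o\<^sub>L i"
      by (simp add: is2) (metis blinfun_compose_assoc iY)
    finally show "(i o\<^sub>L (r o\<^sub>L i)) o\<^sub>L (i o\<^sub>L (r o\<^sub>L i)) = i o\<^sub>L Y o\<^sub>L i" .
  qed
  have "gmean_inv X Y = (s o\<^sub>L i) o\<^sub>L r o\<^sub>L (i o\<^sub>L s)"
    unfolding gmean_inv_def s_def[symmetric] inv root by (simp add: blinfun_compose_assoc)
  then show ?thesis by (simp add: is1 is2 r_def)
qed

text \<open>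
  For \<open>\<epsilon> > 0\<close> the regularized mean is \<open>((X + \<epsilon>)(Y + \<epsilon>))\<^sup>1\<^sup>/\<^sup>2\<close>. It converges in norm to \<open>(X Y)\<^sup>1\<^sup>/\<^sup>2\<close> by
  \<open>norm_root_diff_le\<close>, because \<open>(X + \<epsilon>)(Y + \<epsilon>) - X Y = \<epsilon> X + \<epsilon> Y + \<epsilon>\<^sup>2\<close> is positive and tends to zero.
\<close>

lemma gmean_commuting:
  fixes X Y :: "'h::complex_hilbert_space \<Rightarrow>\<^sub>L 'h"
  assumes X: "positive_op X" and Y: "positive_op Y" and com: "X o\<^sub>L Y = Y o\<^sub>L X"
  shows "X \<sharp> Y = op_sqrt (X o\<^sub>L Y)"
proof (rule gmean_eqI)
  let ?X = "\<lambda>e::real. X + e *\<^sub>R id_blinfun" and ?Y = "\<lambda>e::real. Y + e *\<^sub>R id_blinfun"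
  define R where "R e = op_sqrt (?X e o\<^sub>L ?Y e)" for e
  let ?E = "\<lambda>e::real. (?X e o\<^sub>L ?Y e) - (X o\<^sub>L Y)"
  have posX: "positive_op (?X e)" and posY: "positive_op (?Y e)" if "0 \<le> e" for e
    using X Y that by (auto simp: positive_op_iff_psd intro!: psd_add psd_scaleR psd_id clinear_intros)
  have com': "?X e o\<^sub>L ?Y e = ?Y e o\<^sub>L ?X e" for e
    by (simp add: compose_expand com algebra_simps)
  have pos: "positive_op (?X e o\<^sub>L ?Y e)" if "0 \<le> e" for e
    by (rule positive_op_compose_commuting[OF posX[OF that] posY[OF that] com'])
  have Rgm: "gmean_inv (?X e) (?Y e) = R e" if "0 < e" for e
    unfolding R_def
    by (rule gmean_inv_commuting[OF posX _ that posY com']) (use that X in \<open>simp_all add: positive_op_iff_psd\<close>)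
  define S where "S = op_sqrt (X o\<^sub>L Y)"
  have S0: "S = R 0" by (simp add: S_def R_def)
  have bound: "norm (R e - S) \<le> sqrt (norm (?E e))" if "0 < e" for e
  proof -
    have pe: "positive_op (R e)" "R e o\<^sub>L R e = ?X e o\<^sub>L ?Y e"
      unfolding R_def using that by (auto intro!: op_sqrt_positive op_sqrt_square pos)
    have p0: "positive_op S" "S o\<^sub>L S = X o\<^sub>L Y"
      unfolding S0 R_def using op_sqrt_positive[OF pos[of 0]] op_sqrt_square[OF pos[of 0]] by simp_all
    have XY: "positive_op (X o\<^sub>L Y)" using pos[of 0] by simp
    have cX: "(X o\<^sub>L Y) o\<^sub>L (?X e o\<^sub>L ?Y e) = (?X e o\<^sub>L ?Y e) o\<^sub>L (X o\<^sub>L Y)"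
    proof -
      have c1: "X (Y x) = Y (X x)" for x using com by (metis blinfun_apply_blinfun_compose)
      show ?thesis by (rule blinfun_eqI) (simp add: blinfun.bilinear_simps c1)
    qed
    have "S o\<^sub>L (?X e o\<^sub>L ?Y e) = (?X e o\<^sub>L ?Y e) o\<^sub>L S"
      unfolding S_def by (rule op_sqrt_commute[OF XY cX])
    then have "R e o\<^sub>L S = S o\<^sub>L R e"
      unfolding R_def using that by (intro op_sqrt_commute pos) simp_all
    moreover have "?E e = e *\<^sub>R X + (e *\<^sub>R Y + (e * e) *\<^sub>R id_blinfun)"
      by (simp add: compose_expand algebra_simps)
    then have "psd (?E e)"
      using that X Y by (auto simp: positive_op_iff_psd intro!: psd_add psd_scaleR psd_id)
    ultimately have "(norm (R e - S))\<^sup>2 \<le> norm (?E e)"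
      using norm_root_diff_le[of "R e" S] pe p0 by (simp add: positive_op_iff_psd)
    then show ?thesis by (simp add: real_le_rsqrt)
  qed
  have "((\<lambda>e. sqrt (norm (?E e))) \<longlongrightarrow> sqrt (norm (?E 0))) (at_right 0)"
    by (intro tendsto_intros)
  then have "((\<lambda>e. sqrt (norm (?E e))) \<longlongrightarrow> 0) (at_right 0)" by simp
  then have "((\<lambda>e. R e - S) \<longlongrightarrow> 0) (at_right 0)"
    by (rule Lim_null_comparison[rotated])
      (use bound eventually_at_right_less[of "0::real"] in \<open>auto elim!: eventually_mono\<close>)
  then have "(R \<longlongrightarrow> S) (at_right 0)" by (simp add: LIM_zero_iff)
  then have "((\<lambda>e. gmean_inv (?X e) (?Y e)) \<longlongrightarrow> S) (at_right 0)"
    by (rule Lim_transform_eventually)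
      (use Rgm eventually_at_right_less[of "0::real"] in \<open>auto elim!: eventually_mono\<close>)
  then show "((\<lambda>e. gmean_inv (?X e) (?Y e)) \<longlongrightarrow> op_sqrt (X o\<^sub>L Y)) (at_right 0)"
    by (simp add: S_def)
qed

section \<open>Tracial conditional expectations\<close>

lemma cscale_of_real: "cscale (complex_of_real r) X = r *\<^sub>R X"
  by (rule blinfun_eqI) (simp add: cscale.rep_eq scaleR_scaleC blinfun.scaleR_left)

lemma cstar_algebra_unital_closed_algebra:
  assumes "cstar_algebra \<A>" "id_blinfun \<in> \<A>"
  shows "unital_closed_algebra \<A>"
proof -
  have "c *\<^sub>R X \<in> \<A>" if "X \<in> \<A>" for c X
  proof -
    have "cscale (complex_of_real c) X \<in> \<A>"
      using assms(1) that by (simp add: cstar_algebra_def)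
    then show ?thesis by (simp add: cscale_of_real)
  qed
  with assms show ?thesis by (simp add: cstar_algebra_def unital_closed_algebra_def)
qed

locale tracial_expectation =
  fixes \<A> \<B> :: "('h::complex_hilbert_space \<Rightarrow>\<^sub>L 'h) set"
    and \<E> :: "('h \<Rightarrow>\<^sub>L 'h) \<Rightarrow> ('h \<Rightarrow>\<^sub>L 'h)" and \<rho> :: "'h \<Rightarrow>\<^sub>L 'h"
  assumes A_alg: "cstar_algebra \<A>"
    and B_sub: "cstar_subalgebra \<B> \<A>"
    and E_cond: "conditional_expectation \<A> \<B> \<E>"
    and E_tr: "tracial \<A> \<E>"
    and rho: "density_operator \<A> \<E> \<rho>"
begin

lemma rho_mem: "\<rho> \<in> \<A>" and rho_pos: "positive_op \<rho>" and E_rho: "\<E> \<rho> = id_blinfun"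
  using rho by (simp_all add: density_operator_def)

lemma E_mem: "X \<in> \<A> \<Longrightarrow> \<E> X \<in> \<B>"
  using E_cond by (simp add: conditional_expectation_def)

lemma B_mem_A: "X \<in> \<B> \<Longrightarrow> X \<in> \<A>"
  using B_sub by (auto simp: cstar_subalgebra_def)

text \<open>
  The unit \<open>I = \<E>(\<rho>)\<close> is a value of \<open>\<E>\<close> and hence lies in \<open>\<B>\<close>.
\<close>

lemma B_algebra: "unital_closed_algebra \<B>"
  using B_sub E_mem[OF rho_mem] E_rho
  by (simp add: cstar_subalgebra_def cstar_algebra_unital_closed_algebra)

lemmas B_intros = unital_closed_algebraD(2-)[OF B_algebra]

lemma A_algebra: "unital_closed_algebra \<A>"
  using A_alg B_mem_A[OF B_intros(1)] by (rule cstar_algebra_unital_closed_algebra)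

lemmas A_intros = unital_closed_algebraD(2-)[OF A_algebra]

lemma A_clinear: "X \<in> \<A> \<Longrightarrow> clinear_op X"
  using A_alg by (simp add: cstar_algebra_def)

lemma E_add: "X \<in> \<A> \<Longrightarrow> Y \<in> \<A> \<Longrightarrow> \<E> (X + Y) = \<E> X + \<E> Y"
  using E_cond by (simp add: conditional_expectation_def)

lemma E_cscale: "X \<in> \<A> \<Longrightarrow> \<E> (cscale c X) = cscale c (\<E> X)"
  using E_cond by (simp add: conditional_expectation_def)

lemma E_scaleR: "X \<in> \<A> \<Longrightarrow> \<E> (r *\<^sub>R X) = r *\<^sub>R \<E> X"
  using E_cscale[of X "complex_of_real r"] by (simp add: cscale_of_real)

lemma E_diff: "X \<in> \<A> \<Longrightarrow> Y \<in> \<A> \<Longrightarrow> \<E> (X - Y) = \<E> X - \<E> Y"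
  using E_add[of X "-1 *\<^sub>R Y"] E_scaleR[of Y "-1"] A_intros(3)[of Y "-1"] by simp

lemma E_minus: "X \<in> \<A> \<Longrightarrow> \<E> (- X) = - \<E> X"
  using E_scaleR[of X "-1"] by simp

lemma E_psd: "X \<in> \<A> \<Longrightarrow> psd X \<Longrightarrow> psd (\<E> X)"
  using E_cond A_clinear by (auto simp: conditional_expectation_def positive_op_iff_psd)

lemma E_left: "X \<in> \<A> \<Longrightarrow> Y \<in> \<B> \<Longrightarrow> \<E> (Y o\<^sub>L X) = Y o\<^sub>L \<E> X"
  and E_right: "X \<in> \<A> \<Longrightarrow> Y \<in> \<B> \<Longrightarrow> \<E> (X o\<^sub>L Y) = \<E> X o\<^sub>L Y"
proof -
  have *: "\<E> (Y o\<^sub>L X o\<^sub>L Z) = Y o\<^sub>L \<E> X o\<^sub>L Z" if "X \<in> \<A>" "Y \<in> \<B>" "Z \<in> \<B>" for X Y Z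
    using E_cond that by (simp add: conditional_expectation_def)
  show "X \<in> \<A> \<Longrightarrow> Y \<in> \<B> \<Longrightarrow> \<E> (Y o\<^sub>L X) = Y o\<^sub>L \<E> X"
    "X \<in> \<A> \<Longrightarrow> Y \<in> \<B> \<Longrightarrow> \<E> (X o\<^sub>L Y) = \<E> X o\<^sub>L Y"
    using *[of X Y id_blinfun] *[of X id_blinfun Y] B_intros(1) by simp_all
qed

lemma E_trace: "X \<in> \<A> \<Longrightarrow> Y \<in> \<A> \<Longrightarrow> \<E> (X o\<^sub>L Y) = \<E> (Y o\<^sub>L X)"
  using E_tr by (simp add: tracial_def)

text \<open>
  Both products are values of \<open>\<E>\<close> at cyclic permutations of \<open>\<rho>\<close>, \<open>Z\<close>, \<open>Y\<close>: \<open>Y Z = \<E>(Y (\<rho> Z)) = \<E>((\<rho> Z) Y) = Z Y\<close>.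
  Every later computation in \<open>\<B>\<close> is commutative because of this.
\<close>

lemma B_commute: "Y \<in> \<B> \<Longrightarrow> Z \<in> \<B> \<Longrightarrow> Y o\<^sub>L Z = Z o\<^sub>L Y"
  using E_trace[of Y "\<rho> o\<^sub>L Z"] E_left[of "\<rho> o\<^sub>L Z" Y] E_right[of "\<rho> o\<^sub>L Z" Y] E_right[of \<rho> Z]
  by (simp add: E_rho B_mem_A rho_mem A_intros)

lemma B_left_commute: "X \<in> \<B> \<Longrightarrow> Y \<in> \<B> \<Longrightarrow> Y o\<^sub>L (X o\<^sub>L Z) = X o\<^sub>L (Y o\<^sub>L Z)"
  by (metis B_commute blinfun_compose_assoc)

text \<open>
  A symmetric \<open>X\<close> is the difference of the positive operators \<open>X + \<parallel>X\<parallel> I\<close> and \<open>\<parallel>X\<parallel> I\<close>, on which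
  \<open>\<E>\<close> preserves positivity and hence symmetry.
\<close>

lemma E_symmetric:
  assumes "X \<in> \<A>" "is_adjoint X X" shows "is_adjoint (\<E> X) (\<E> X)"
proof -
  let ?k = "norm X *\<^sub>R (id_blinfun :: 'h \<Rightarrow>\<^sub>L 'h)"
  have k: "?k \<in> \<A>" by (intro A_intros)
  have "is_adjoint (\<E> (X + ?k) - \<E> ?k) (\<E> (X + ?k) - \<E> ?k)"
    using psd_norm_bounds(2)[OF assms(2) order_refl] assms(1) k psd_scaleR[OF norm_ge_zero psd_id]
    by (intro is_adjoint_diff psd_adj E_psd A_intros) auto
  then show ?thesis using assms(1) k by (simp add: E_add)
qed

text \<open>
  Both \<open>X' + X\<close> and \<open>\<i> (X' - X)\<close> are symmetric; the symmetry of their images under \<open>\<E>\<close> is equivalent to the claim.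
\<close>

lemma E_adjoint:
  assumes X: "X \<in> \<A>" and X': "X' \<in> \<A>" and adj: "is_adjoint X' X"
  shows "is_adjoint (\<E> X') (\<E> X)"
proof -
  let ?S = "X' + X" and ?D = "X' - X"
  have D: "?D \<in> \<A>" by (intro A_intros X X')
  then have iD: "cscale \<i> ?D \<in> \<A>" using A_alg by (simp add: cstar_algebra_def)
  have a1: "inner (X' u) v = inner u (X v)" "inner (X u) v = inner u (X' v)" for u v
    using adj is_adjoint_sym[OF adj] by (simp_all add: is_adjoint_def)
  have "is_adjoint (\<E> ?S) (\<E> ?S)"
    by (intro E_symmetric A_intros X X')
      (use is_adjoint_add[OF adj is_adjoint_sym[OF adj]] in \<open>simp add: add.commute\<close>)
  then have 1: "inner (\<E> X' u + \<E> X u) v = inner u (\<E> X' v + \<E> X v)" for u v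
    using X X' by (simp add: E_add is_adjoint_def blinfun.add_left)
  have cD: "clinear_op (\<E> ?D)" using E_mem[OF D] B_mem_A A_clinear by blast
  have "is_adjoint (cscale \<i> ?D) (cscale \<i> ?D)"
    unfolding is_adjoint_def
  proof (intro allI)
    fix u v
    have "inner (cscale \<i> ?D u) v = - inner (?D u) (\<i> *\<^sub>C v)"
      by (simp add: cscale.rep_eq inner_imaginary(2))
    also have "\<dots> = inner u (?D (\<i> *\<^sub>C v))"
      by (simp add: blinfun.bilinear_simps inner_diff_left inner_diff_right a1)
    also have "\<dots> = inner u (cscale \<i> ?D v)"
      by (simp add: cscale.rep_eq clinear_opD[OF A_clinear[OF D]])
    finally show "inner (cscale \<i> ?D u) v = inner u (cscale \<i> ?D v)" .
  qed
  from E_symmetric[OF iD this] have "is_adjoint (cscale \<i> (\<E> ?D)) (cscale \<i> (\<E> ?D))"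
    by (simp add: E_cscale D)
  then have "inner (cscale \<i> (\<E> ?D) u) (\<i> *\<^sub>C v) = inner u (cscale \<i> (\<E> ?D) (\<i> *\<^sub>C v))" for u v
    by (simp add: is_adjoint_def)
  then have 2: "inner (\<E> ?D u) v = - inner u (\<E> ?D v)" for u v
    by (simp add: cscale.rep_eq inner_imaginary clinear_opD[OF cD] scaleC_scaleC scaleC_minus_left
        scaleC_one)
  show ?thesis
    unfolding is_adjoint_def
  proof (intro allI)
    fix u v
    show "inner (\<E> X' u) v = inner u (\<E> X v)"
      using 1[of u v] 2[of u v] X X'
      by (simp add: E_diff blinfun.bilinear_simps inner_add_left inner_add_right
          inner_diff_left inner_diff_right)
  qed
qed

text \<open>
  With \<open>a = \<E>(X\<^sup>* X)\<close>, \<open>b = \<E>(Y\<^sup>* Y)\<close> and \<open>c = \<E>(Y\<^sup>* X)\<close>, the vector \<open>Z = X b - Y c\<close> is, up to the factor \<open>b\<close>,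
  the part of \<open>X\<close> orthogonal to \<open>Y\<close>, and \<open>\<E>(Z\<^sup>* Z) = b (a b - c\<^sup>* c)\<close>. To divide by \<open>b\<close>, it is replaced
  by the coercive \<open>\<beta> = b + e\<close>, which leaves the positive remainder \<open>e c\<^sup>* c\<close>; then \<open>e\<close> tends to zero.
\<close>

lemma E_Cauchy_Schwarz:
  assumes A: "X \<in> \<A>" "X' \<in> \<A>" "Y \<in> \<A>" "Y' \<in> \<A>"
    and X: "is_adjoint X' X" and Y: "is_adjoint Y' Y"
  shows "psd ((\<E> (X' o\<^sub>L X) o\<^sub>L \<E> (Y' o\<^sub>L Y)) - (\<E> (X' o\<^sub>L Y) o\<^sub>L \<E> (Y' o\<^sub>L X)))"
proof -
  define a b c c' where "a = \<E> (X' o\<^sub>L X)" and "b = \<E> (Y' o\<^sub>L Y)" and "c = \<E> (Y' o\<^sub>L X)"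
    and "c' = \<E> (X' o\<^sub>L Y)"
  have mem: "a \<in> \<B>" "b \<in> \<B>" "c \<in> \<B>" "c' \<in> \<B>"
    unfolding a_def b_def c_def c'_def by (intro E_mem A_intros A)+
  have adjc: "is_adjoint c' c"
    unfolding c_def c'_def
    by (intro E_adjoint A_intros A is_adjoint_compose X is_adjoint_sym[OF Y])
  have a: "psd a" and b: "psd b"
    unfolding a_def b_def by (intro E_psd A_intros A psd_adjoint_compose X Y)+
  have "psd ((a o\<^sub>L b) - (c' o\<^sub>L c) + e *\<^sub>R a)" if e: "0 < e" for e :: real
  proof -
    define \<beta> where "\<beta> = b + e *\<^sub>R id_blinfun"
    have \<beta>: "\<beta> \<in> \<B>" unfolding \<beta>_def by (intro B_intros mem)
    have sym\<beta>: "is_adjoint \<beta> \<beta>" unfolding \<beta>_def by (intro is_adjoint_intros psd_adj b)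
    let ?Z = "(X o\<^sub>L \<beta>) - (Y o\<^sub>L c)" and ?Z' = "(\<beta> o\<^sub>L X') - (c' o\<^sub>L Y')"
    let ?D = "(\<beta> o\<^sub>L a) - (c' o\<^sub>L c)"
    note memA = A mem[THEN B_mem_A] \<beta>[THEN B_mem_A]
    have pos: "psd (\<E> (?Z' o\<^sub>L ?Z))"
      by (intro E_psd A_intros memA psd_adjoint_compose is_adjoint_diff is_adjoint_compose
          sym\<beta> X Y adjc)
    have t: "\<E> (l o\<^sub>L (P o\<^sub>L (Q o\<^sub>L r))) = l o\<^sub>L (\<E> (P o\<^sub>L Q) o\<^sub>L r)"
      if "l \<in> \<B>" "r \<in> \<B>" "P \<in> \<A>" "Q \<in> \<A>" for l r P Q
    proof -
      have "\<E> (l o\<^sub>L ((P o\<^sub>L Q) o\<^sub>L r)) = l o\<^sub>L (\<E> (P o\<^sub>L Q) o\<^sub>L r)"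
        by (simp only: E_left E_right that A_intros B_mem_A)
      then show ?thesis by (simp only: blinfun_compose_assoc)
    qed
    have "\<E> (?Z' o\<^sub>L ?Z) = (\<beta> o\<^sub>L (a o\<^sub>L \<beta>)) - (\<beta> o\<^sub>L (c' o\<^sub>L c)) - ((c' o\<^sub>L (c o\<^sub>L \<beta>)) - (c' o\<^sub>L (b o\<^sub>L c)))"
      by (simp add: compose_expand E_diff A_intros memA t \<beta> mem a_def[symmetric] b_def[symmetric]
          c_def[symmetric] c'_def[symmetric])
    also have "\<dots> = (\<beta> o\<^sub>L ?D) - ((\<beta> - b) o\<^sub>L (c' o\<^sub>L c))"
      by (simp add: compose_expand B_commute[OF mem(1) \<beta>] B_commute[OF mem(3) \<beta>]
          B_left_commute[OF \<beta> mem(4)] B_left_commute[OF mem(2) mem(4)])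
    also have "\<dots> = (\<beta> o\<^sub>L ?D) - e *\<^sub>R (c' o\<^sub>L c)"
      by (simp add: \<beta>_def compose_expand)
    finally have "\<beta> o\<^sub>L ?D = \<E> (?Z' o\<^sub>L ?Z) + e *\<^sub>R (c' o\<^sub>L c)" by simp
    also have "psd \<dots>"
      using e by (intro psd_add pos psd_scaleR psd_adjoint_compose adjc) simp_all
    finally have \<beta>D: "psd (\<beta> o\<^sub>L ?D)" .
    have "psd ?D"
    proof (rule psd_cancel_coercive[OF _ e _ _ \<beta>D])
      show "psd (\<beta> - e *\<^sub>R id_blinfun)" by (simp add: \<beta>_def b)
      have "is_adjoint (\<beta> o\<^sub>L a) (\<beta> o\<^sub>L a)"
        using is_adjoint_compose[OF sym\<beta> psd_adj[OF a]] by (simp add: B_commute[OF mem(1) \<beta>])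
      then show "is_adjoint ?D ?D"
        by (intro is_adjoint_diff is_adjoint_compose[OF adjc is_adjoint_sym[OF adjc]])
      show "\<beta> o\<^sub>L ?D = ?D o\<^sub>L \<beta>" by (intro B_commute B_intros \<beta> mem)
    qed
    also have "?D = (a o\<^sub>L b) - (c' o\<^sub>L c) + e *\<^sub>R a"
      by (simp add: \<beta>_def compose_expand B_commute[OF mem(2,1)])
    finally show ?thesis .
  qed
  then show ?thesis
    unfolding a_def[symmetric] b_def[symmetric] c_def[symmetric] c'_def[symmetric]
    by (rule psd_of_psd_add_eps)
qed

section \<open>The uncertainty relation\<close>

definition s where "s = op_sqrt \<rho>"

lemma s_mem: "s \<in> \<A>" and s_psd: "psd s" and s_square: "s o\<^sub>L s = \<rho>"
  using op_sqrt_in_algebra[OF rho_pos A_algebra rho_mem] op_sqrt_positive[OF rho_pos]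
    op_sqrt_square[OF rho_pos] by (simp_all add: s_def positive_op_iff_psd)

lemma s_s_left: "s o\<^sub>L (s o\<^sub>L X) = \<rho> o\<^sub>L X"
  by (simp flip: blinfun_compose_assoc add: s_square)

definition centred where "centred H = H - \<E> (\<rho> o\<^sub>L H)"
text \<open>
  For symmetric \<open>H\<close> the skew part \<open>X\<close> is skew-adjoint and the symmetric part is symmetric. Up to a factor
  \<open>2\<close>, \<open>I(H)\<close> is \<open>\<E>(X\<^sup>* X)\<close>, and \<open>J(H)\<close> is \<open>\<E>(Y\<^sup>2)\<close> for the symmetric part \<open>Y\<close> of the centred \<open>H\<close>.
\<close>

definition skew_part where "skew_part H = (s o\<^sub>L H) - (H o\<^sub>L s)"
definition sym_part where "sym_part H = (s o\<^sub>L H) + (H o\<^sub>L s)"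

lemma part_mem: "H \<in> \<A> \<Longrightarrow> centred H \<in> \<A>" "H \<in> \<A> \<Longrightarrow> skew_part H \<in> \<A>" "H \<in> \<A> \<Longrightarrow> sym_part H \<in> \<A>"
  unfolding centred_def skew_part_def sym_part_def
  by (simp_all add: A_intros B_mem_A E_mem s_mem rho_mem)

text \<open>
  The cyclic permutations, under the trace property, of all words with two letters \<open>s\<close> that occur below.
\<close>

lemma E_cycle:
  assumes "H \<in> \<A>" "G \<in> \<A>"
  shows "\<E> (s o\<^sub>L (H o\<^sub>L (G o\<^sub>L s))) = \<E> (\<rho> o\<^sub>L (H o\<^sub>L G))"
    and "\<E> (H o\<^sub>L (\<rho> o\<^sub>L G)) = \<E> (\<rho> o\<^sub>L (G o\<^sub>L H))"
    and "\<E> (H o\<^sub>L (s o\<^sub>L (G o\<^sub>L s))) = \<E> (s o\<^sub>L (H o\<^sub>L (s o\<^sub>L G)))"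
  using E_trace[of "s o\<^sub>L (H o\<^sub>L G)" s] E_trace[of H "\<rho> o\<^sub>L G"]
    E_trace[of "H o\<^sub>L (s o\<^sub>L G)" s] assms
  by (simp_all add: s_s_left blinfun_compose_assoc A_intros s_mem rho_mem)

text \<open>
  Elements of \<open>\<B>\<close> leave \<open>\<E>(\<rho> \<dots>)\<close> from either side of \<open>H\<close>, although they need not commute with \<open>H\<close> or
  \<open>\<rho>\<close>: cycling \<open>\<rho>\<close> to the other end puts them at the boundary.
\<close>

lemma E_rho_B:
  assumes "H \<in> \<A>" "b \<in> \<B>"
  shows "\<E> (\<rho> o\<^sub>L (b o\<^sub>L H)) = b o\<^sub>L \<E> (\<rho> o\<^sub>L H)" "\<E> (\<rho> o\<^sub>L (H o\<^sub>L b)) = b o\<^sub>L \<E> (\<rho> o\<^sub>L H)"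
proof -
  have mem: "\<rho> o\<^sub>L H \<in> \<A>" "H o\<^sub>L \<rho> \<in> \<A>" "b o\<^sub>L H \<in> \<A>" using assms by (simp_all add: A_intros rho_mem B_mem_A)
  have "\<E> (\<rho> o\<^sub>L (b o\<^sub>L H)) = \<E> (b o\<^sub>L (H o\<^sub>L \<rho>))"
    using E_trace[OF rho_mem mem(3)] by (simp add: blinfun_compose_assoc)
  also have "\<dots> = b o\<^sub>L \<E> (\<rho> o\<^sub>L H)"
    using E_left[OF mem(2) assms(2)] E_trace[OF assms(1) rho_mem] by simp
  finally show "\<E> (\<rho> o\<^sub>L (b o\<^sub>L H)) = b o\<^sub>L \<E> (\<rho> o\<^sub>L H)" .
  show "\<E> (\<rho> o\<^sub>L (H o\<^sub>L b)) = b o\<^sub>L \<E> (\<rho> o\<^sub>L H)"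
    using E_right[OF mem(1) assms(2)] B_commute[OF assms(2) E_mem[OF mem(1)]]
    by (simp add: blinfun_compose_assoc)
qed

lemma E_skew_part_square:
  assumes "H \<in> \<A>"
  shows "\<E> (skew_part H o\<^sub>L skew_part H) = (-2) *\<^sub>R I_op \<rho> \<E> H"
  using assms
  by (simp add: skew_part_def compose_expand E_add E_diff E_cycle s_s_left A_intros s_mem rho_mem I_op_def s_def[symmetric]
      scaleR_2 algebra_simps)

lemma E_sym_part_square:
  assumes "H \<in> \<A>"
  shows "\<E> (sym_part H o\<^sub>L sym_part H) = 2 *\<^sub>R (\<E> (\<rho> o\<^sub>L (H o\<^sub>L H)) + \<E> (s o\<^sub>L (H o\<^sub>L (s o\<^sub>L H))))"
  using assms
  by (simp add: sym_part_def compose_expand E_add E_cycle s_s_left A_intros s_mem rho_mem scaleR_2 algebra_simps)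

text \<open>
  Write \<open>a = \<E>(\<rho> H)\<close>. Centring lowers both \<open>\<E>(\<rho> H\<^sup>2)\<close> and \<open>\<E>(s H s H)\<close> by \<open>a\<^sup>2\<close>, and \<open>J\<close> is their sum minus \<open>2 a\<^sup>2\<close>.
\<close>

lemma E_sym_part_centred_square:
  assumes H: "H \<in> \<A>"
  shows "\<E> (sym_part (centred H) o\<^sub>L sym_part (centred H)) = 2 *\<^sub>R J_op \<rho> \<E> H"
proof -
  define a where "a = \<E> (\<rho> o\<^sub>L H)"
  have a: "a \<in> \<B>" and aA: "a \<in> \<A>" unfolding a_def by (intro E_mem B_mem_A A_intros rho_mem H)+
  have Ea: "\<E> (\<rho> o\<^sub>L a) = a" using E_right[OF rho_mem a] by (simp add: E_rho)
  have r: "\<E> (\<rho> o\<^sub>L (a o\<^sub>L H)) = a o\<^sub>L a" "\<E> (\<rho> o\<^sub>L (H o\<^sub>L a)) = a o\<^sub>L a"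
    "\<E> (\<rho> o\<^sub>L (a o\<^sub>L a)) = a o\<^sub>L a"
    using E_rho_B[OF H a] E_rho_B(1)[OF aA a] by (simp_all add: a_def[symmetric] Ea)
  have sHs: "\<E> (s o\<^sub>L (G o\<^sub>L s)) = \<E> (\<rho> o\<^sub>L G)" if "G \<in> \<A>" for G
    using E_cycle(1)[OF that A_intros(1)] by simp
  have t: "\<E> (s o\<^sub>L (G o\<^sub>L (s o\<^sub>L a))) = \<E> (\<rho> o\<^sub>L G) o\<^sub>L a" if "G \<in> \<A>" for G
    using E_right[OF A_intros(4)[OF s_mem A_intros(4)[OF that s_mem]] a] sHs[OF that]
    by (simp add: blinfun_compose_assoc)
  have t': "\<E> (s o\<^sub>L (a o\<^sub>L (s o\<^sub>L H))) = \<E> (s o\<^sub>L (H o\<^sub>L (s o\<^sub>L a)))"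
    using E_trace[of "s o\<^sub>L a" "s o\<^sub>L H"] by (simp add: blinfun_compose_assoc A_intros s_mem H aA)
  have c1: "\<E> (\<rho> o\<^sub>L (centred H o\<^sub>L centred H)) = \<E> (\<rho> o\<^sub>L (H o\<^sub>L H)) - (a o\<^sub>L a)"
    by (simp add: centred_def a_def[symmetric] compose_expand E_diff A_intros rho_mem H aA r)
  have c2: "\<E> (s o\<^sub>L (centred H o\<^sub>L (s o\<^sub>L centred H))) = \<E> (s o\<^sub>L (H o\<^sub>L (s o\<^sub>L H))) - (a o\<^sub>L a)"
    by (simp add: centred_def a_def[symmetric] compose_expand E_diff A_intros s_mem H aA t' t Ea)
  have "\<E> (sym_part (centred H) o\<^sub>L sym_part (centred H))
      = 2 *\<^sub>R ((\<E> (\<rho> o\<^sub>L (H o\<^sub>L H)) - (a o\<^sub>L a)) + (\<E> (s o\<^sub>L (H o\<^sub>L (s o\<^sub>L H))) - (a o\<^sub>L a)))"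
    by (simp only: E_sym_part_square part_mem H c1 c2)
  also have "\<dots> = 2 *\<^sub>R J_op \<rho> \<E> H"
    by (simp add: J_op_def V_op_def I_op_def s_def[symmetric]
        a_def[symmetric] blinfun_compose_assoc scaleR_2 algebra_simps)
  finally show ?thesis .
qed

text \<open>
  The two words \<open>s H s G\<close> cancel by cyclicity, which leaves \<open>\<E>(\<rho> H G) - \<E>(\<rho> G H)\<close>; the centring of \<open>G\<close>
  drops out because an element of \<open>\<B>\<close> gives the same value on both sides of \<open>H\<close>.
\<close>

lemma E_skew_part_sym_part:
  assumes H: "H \<in> \<A>" and G: "G \<in> \<A>"
  shows "\<E> (skew_part H o\<^sub>L sym_part (centred G)) = \<E> (\<rho> o\<^sub>L commutator H G)"
proof -
  define b where "b = \<E> (\<rho> o\<^sub>L G)"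
  have b: "b \<in> \<B>" and bA: "b \<in> \<A>" unfolding b_def by (intro E_mem B_mem_A A_intros rho_mem G)+
  have cG: "centred G \<in> \<A>" by (rule part_mem[OF G])
  have "\<E> (skew_part H o\<^sub>L sym_part (centred G))
      = \<E> (\<rho> o\<^sub>L (H o\<^sub>L centred G)) - \<E> (\<rho> o\<^sub>L (centred G o\<^sub>L H))"
    by (simp add: skew_part_def sym_part_def compose_expand E_diff E_add E_cycle s_s_left A_intros s_mem rho_mem H cG)
  also have "\<dots> = \<E> (\<rho> o\<^sub>L commutator H G)"
    by (simp add: centred_def b_def[symmetric] compose_expand commutator_def E_diff A_intros rho_mem
        H G bA E_rho_B[OF H b])
  finally show ?thesis .
qed

lemma adjoint_parts:
  assumes H: "is_adjoint H H"
  shows "is_adjoint (- skew_part H) (skew_part H)" "is_adjoint (sym_part H) (sym_part H)"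
proof -
  note s = psd_adj[OF s_psd]
  show "is_adjoint (- skew_part H) (skew_part H)"
    using is_adjoint_diff[OF is_adjoint_compose[OF H s] is_adjoint_compose[OF s H]]
    by (simp add: skew_part_def)
  show "is_adjoint (sym_part H) (sym_part H)"
    using is_adjoint_add[OF is_adjoint_compose[OF s H] is_adjoint_compose[OF H s]]
    by (simp add: sym_part_def add.commute)
qed

lemma adjoint_centred:
  assumes "H \<in> \<A>" "is_adjoint H H"
  shows "is_adjoint (centred H) (centred H)"
proof -
  have "is_adjoint (\<E> (H o\<^sub>L \<rho>)) (\<E> (\<rho> o\<^sub>L H))"
    by (intro E_adjoint A_intros rho_mem assms is_adjoint_compose psd_adj positive_op_psd rho_pos)
  then show ?thesis
    unfolding centred_def using E_trace[OF assms(1) rho_mem] by (intro is_adjoint_diff assms) simp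
qed

lemma I_op_psd:
  assumes "H \<in> \<A>" "is_adjoint H H" shows "psd (I_op \<rho> \<E> H)"
proof -
  have "psd (\<E> (- skew_part H o\<^sub>L skew_part H))"
    using A_intros(3)[OF part_mem(2)[OF assms(1)], of "-1"]
    by (intro E_psd psd_adjoint_compose adjoint_parts assms A_intros part_mem) simp
  then have "psd (2 *\<^sub>R I_op \<rho> \<E> H)"
    using assms(1) by (simp add: compose_expand E_minus A_intros part_mem E_skew_part_square)
  from psd_scaleR[OF _ this, of "1/2"] show ?thesis by simp
qed

lemma J_op_psd:
  assumes "H \<in> \<A>" "is_adjoint H H" shows "psd (J_op \<rho> \<E> H)"
proof -
  have "psd (\<E> (sym_part (centred H) o\<^sub>L sym_part (centred H)))"
    by (intro E_psd psd_adjoint_compose adjoint_parts adjoint_centred assms A_intros part_mem)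
  from psd_scaleR[OF _ this, of "1/2"] show ?thesis by (simp add: E_sym_part_centred_square assms)
qed

lemma I_J_mem: "H \<in> \<A> \<Longrightarrow> I_op \<rho> \<E> H \<in> \<B>" "H \<in> \<A> \<Longrightarrow> J_op \<rho> \<E> H \<in> \<B>"
  unfolding I_op_def J_op_def V_op_def s_def[symmetric]
  by (simp_all add: B_intros E_mem A_intros rho_mem s_mem)

lemma commutator_mem: "H \<in> \<A> \<Longrightarrow> G \<in> \<A> \<Longrightarrow> commutator H G \<in> \<A>"
  unfolding commutator_def by (intro A_intros)

lemma adjoint_E_commutator:
  assumes H: "H \<in> \<A>" "is_adjoint H H" and G: "G \<in> \<A>" "is_adjoint G G"
  shows "is_adjoint (- \<E> (\<rho> o\<^sub>L commutator H G)) (\<E> (\<rho> o\<^sub>L commutator H G))"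
proof -
  let ?C = "commutator H G"
  have C: "?C \<in> \<A>" by (rule commutator_mem[OF H(1) G(1)])
  have "is_adjoint (- ?C) ?C"
    using is_adjoint_diff[OF is_adjoint_compose[OF G(2) H(2)] is_adjoint_compose[OF H(2) G(2)]]
    by (simp add: commutator_def)
  then have "is_adjoint (- ?C o\<^sub>L \<rho>) (\<rho> o\<^sub>L ?C)"
    by (intro is_adjoint_compose psd_adj positive_op_psd rho_pos)
  then have "is_adjoint (\<E> (- ?C o\<^sub>L \<rho>)) (\<E> (\<rho> o\<^sub>L ?C))"
    using A_intros(3)[OF C, of "-1"] by (intro E_adjoint A_intros rho_mem C) simp_all
  then show ?thesis
    using E_trace[OF C rho_mem] C by (simp add: compose_expand E_minus A_intros rho_mem)
qed

text \<open>
  Cauchy--Schwarz for the skew part of \<open>H\<close> and the symmetric part of the centred \<open>G\<close>. As \<open>C\<^sup>* = - C\<close>, the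
  product \<open>- C C\<close> is \<open>|C|\<^sup>2\<close>.
\<close>

lemma I_J_uncertainty:
  assumes H: "H \<in> \<A>" "is_adjoint H H" and G: "G \<in> \<A>" "is_adjoint G G"
  defines "C \<equiv> \<E> (\<rho> o\<^sub>L commutator H G)"
  shows "psd ((I_op \<rho> \<E> H o\<^sub>L J_op \<rho> \<E> G) - (1/4) *\<^sub>R (- C o\<^sub>L C))"
proof -
  let ?X = "skew_part H" and ?Y = "sym_part (centred G)"
  have X: "?X \<in> \<A>" "- ?X \<in> \<A>" and Y: "?Y \<in> \<A>"
    using A_intros(3)[OF part_mem(2)[OF H(1)], of "-1"] by (auto intro: part_mem H G)
  have "psd ((\<E> (- ?X o\<^sub>L ?X) o\<^sub>L \<E> (?Y o\<^sub>L ?Y)) - (\<E> (- ?X o\<^sub>L ?Y) o\<^sub>L \<E> (?Y o\<^sub>L ?X)))"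
    by (intro E_Cauchy_Schwarz X Y adjoint_parts adjoint_centred H G)
  moreover have "\<E> (- ?X o\<^sub>L ?Y) = - C" "\<E> (?Y o\<^sub>L ?X) = C"
    using E_trace[OF Y X(1)] E_skew_part_sym_part[OF H(1) G(1)] X Y
    by (simp_all add: C_def compose_expand E_minus A_intros)
  moreover have "\<E> (- ?X o\<^sub>L ?X) = 2 *\<^sub>R I_op \<rho> \<E> H" "\<E> (?Y o\<^sub>L ?Y) = 2 *\<^sub>R J_op \<rho> \<E> G"
    using X(1) by (simp_all add: compose_expand E_minus A_intros E_skew_part_square
        E_sym_part_centred_square H G)
  ultimately have "psd (4 *\<^sub>R (I_op \<rho> \<E> H o\<^sub>L J_op \<rho> \<E> G) - (- C o\<^sub>L C))"
    by (simp add: compose_expand)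
  from psd_scaleR[OF _ this, of "1/4"] show ?thesis by (simp add: scaleR_diff_right)
qed

lemma U_op_root:
  assumes "H \<in> \<A>" "is_adjoint H H"
  shows "positive_op (U_op \<rho> \<E> H)" "U_op \<rho> \<E> H \<in> \<B>"
    "U_op \<rho> \<E> H o\<^sub>L U_op \<rho> \<E> H = I_op \<rho> \<E> H o\<^sub>L J_op \<rho> \<E> H"
proof -
  let ?I = "I_op \<rho> \<E> H" and ?J = "J_op \<rho> \<E> H"
  have mem: "?I \<in> \<B>" "?J \<in> \<B>" by (intro I_J_mem assms)+
  have I: "positive_op ?I" and J: "positive_op ?J"
    using mem assms by (auto intro!: positive_opI I_op_psd J_op_psd A_clinear B_mem_A)
  have com: "?I o\<^sub>L ?J = ?J o\<^sub>L ?I" by (rule B_commute[OF mem])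
  have IJ: "positive_op (?I o\<^sub>L ?J)" by (rule positive_op_compose_commuting[OF I J com])
  have "U_op \<rho> \<E> H = op_sqrt (?I o\<^sub>L ?J)"
    unfolding U_op_def by (rule gmean_commuting[OF I J com])
  then show "positive_op (U_op \<rho> \<E> H)" "U_op \<rho> \<E> H \<in> \<B>"
    "U_op \<rho> \<E> H o\<^sub>L U_op \<rho> \<E> H = ?I o\<^sub>L ?J"
    using op_sqrt_positive[OF IJ] op_sqrt_square[OF IJ]
      op_sqrt_in_algebra[OF IJ B_algebra B_intros(4)[OF mem]] by simp_all
qed

text \<open>
  For \<open>P = I(H) J(G)\<close> and \<open>Q = I(G) J(H)\<close>, both at least \<open>K \<ge> 0\<close>, the decomposition
  \<open>P Q - K\<^sup>2 = (P - K) Q + K (Q - K)\<close> exhibits a sum of products of commuting positive operators, and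
  \<open>P Q\<close> is the square of \<open>U(H) U(G)\<close>.
\<close>

lemma U_uncertainty:
  assumes H: "H \<in> \<A>" "is_adjoint H H" and G: "G \<in> \<A>" "is_adjoint G G"
  defines "C \<equiv> \<E> (\<rho> o\<^sub>L commutator H G)"
  shows "psd ((U_op \<rho> \<E> H o\<^sub>L U_op \<rho> \<E> G) - (1/4) *\<^sub>R (- C o\<^sub>L C))"
proof -
  let ?I = "I_op \<rho> \<E>" and ?J = "J_op \<rho> \<E>" and ?U = "U_op \<rho> \<E>"
  define K where "K = (1/4) *\<^sub>R (- C o\<^sub>L C)"
  have C: "C \<in> \<B>" unfolding C_def by (intro E_mem A_intros rho_mem commutator_mem H G)
  have K: "K \<in> \<B>"
    unfolding K_def using B_intros(3)[OF C, of "-1"] by (intro B_intros C) simp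
  have Kpsd: "psd K"
    unfolding K_def C_def by (intro psd_scaleR psd_adjoint_compose adjoint_E_commutator H G) simp
  let ?P = "?I H o\<^sub>L ?J G" and ?Q = "?I G o\<^sub>L ?J H"
  have mem: "?I H \<in> \<B>" "?J H \<in> \<B>" "?I G \<in> \<B>" "?J G \<in> \<B>" "?U H \<in> \<B>" "?U G \<in> \<B>"
    by (intro I_J_mem U_op_root H G)+
  have 1: "psd (?P - K)" unfolding K_def C_def by (rule I_J_uncertainty[OF H G])
  have "commutator G H = - commutator H G" by (simp add: commutator_def)
  then have "\<E> (\<rho> o\<^sub>L commutator G H) = - C"
    unfolding C_def by (simp add: compose_expand E_minus A_intros rho_mem commutator_mem H G)
  then have 2: "psd (?Q - K)"
    using I_J_uncertainty[OF G H] by (simp add: K_def compose_expand)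
  have Qpsd: "psd ?Q"
    by (intro psd_compose_commuting I_op_psd J_op_psd H G B_commute mem)
  have UU: "psd (?U H o\<^sub>L ?U G)"
    by (intro psd_compose_commuting positive_op_psd U_op_root H G B_commute mem)
  have "psd (((?P - K) o\<^sub>L ?Q) + (K o\<^sub>L (?Q - K)))"
    by (intro psd_add psd_compose_commuting 1 2 Kpsd Qpsd B_commute B_intros mem K)
  also have "((?P - K) o\<^sub>L ?Q) + (K o\<^sub>L (?Q - K)) = (?P o\<^sub>L ?Q) - (K o\<^sub>L K)"
    by (simp add: compose_expand)
  also have "?P o\<^sub>L ?Q = (?I H o\<^sub>L ?J H) o\<^sub>L (?I G o\<^sub>L ?J G)"
    by (simp add: blinfun_compose_assoc B_commute[OF mem(4,2)] B_left_commute[OF mem(3,4)]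
        B_left_commute[OF mem(3,2)])
  also have "\<dots> = (?U H o\<^sub>L ?U H) o\<^sub>L (?U G o\<^sub>L ?U G)" by (simp only: U_op_root H G)
  also have "\<dots> = (?U H o\<^sub>L ?U G) o\<^sub>L (?U H o\<^sub>L ?U G)"
    by (simp add: blinfun_compose_assoc B_left_commute[OF mem(5,6)])
  finally show ?thesis
    unfolding K_def[symmetric]
    by (rule psd_root_mono[OF UU Kpsd B_commute[OF B_intros(4)[OF mem(5,6)] K]])
qed

end

theorem theorem3p6:
  fixes \<A> \<B> :: "('h::complex_hilbert_space \<Rightarrow>\<^sub>L 'h) set"
    and \<E> :: "('h \<Rightarrow>\<^sub>L 'h) \<Rightarrow> ('h \<Rightarrow>\<^sub>L 'h)"
    and \<rho> A B :: "'h \<Rightarrow>\<^sub>L 'h"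
  assumes "cstar_algebra \<A>"
    and "cstar_subalgebra \<B> \<A>"
    and "conditional_expectation \<A> \<B> \<E>"
    and "tracial \<A> \<E>"
    and "density_operator \<A> \<E> \<rho>"
    and "A \<in> \<A>" and "self_adjoint A"
    and "B \<in> \<A>" and "self_adjoint B"
  shows "(1/4) *\<^sub>R (op_abs (\<E> (\<rho> o\<^sub>L commutator A B)) o\<^sub>L op_abs (\<E> (\<rho> o\<^sub>L commutator A B)))
           \<le>\<^sub>o\<^sub>p (U_op \<rho> \<E> A o\<^sub>L U_op \<rho> \<E> B)"
proof -
  interpret tracial_expectation \<A> \<B> \<E> \<rho> by unfold_locales (fact assms)+
  have A: "A \<in> \<A>" "is_adjoint A A" and B: "B \<in> \<A>" "is_adjoint B B"
    using assms is_adjoint_adj[OF A_clinear[OF assms(6)]] is_adjoint_adj[OF A_clinear[OF assms(8)]]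
    by (simp_all add: self_adjoint_def)
  define C where "C = \<E> (\<rho> o\<^sub>L commutator A B)"
  have C: "C \<in> \<B>" unfolding C_def by (intro E_mem A_intros rho_mem commutator_mem A B)
  have adjC: "is_adjoint (- C) C" unfolding C_def by (rule adjoint_E_commutator[OF A B])
  have mem: "- C o\<^sub>L C \<in> \<B>" using B_intros(3)[OF C, of "-1"] by (intro B_intros C) simp
  have "adj C = - C"
    by (rule is_adjoint_unique[OF is_adjoint_adj adjC]) (intro A_clinear B_mem_A C)
  moreover have "positive_op (- C o\<^sub>L C)"
    by (intro positive_opI A_clinear B_mem_A mem psd_adjoint_compose adjC)
  ultimately have "op_abs C o\<^sub>L op_abs C = - C o\<^sub>L C"
    by (simp add: op_abs_def op_sqrt_square)
  moreover have "positive_op ((U_op \<rho> \<E> A o\<^sub>L U_op \<rho> \<E> B) - (1/4) *\<^sub>R (- C o\<^sub>L C))"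
    unfolding C_def
    by (intro positive_opI U_uncertainty A B A_clinear B_mem_A B_intros U_op_root
        mem[unfolded C_def])
  ultimately show ?thesis by (simp add: op_le_def C_def)
qed

end
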